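(* Let $H$ be a bipartite graph, and let $k_1 = \min \max(|A|,|B|)$ and $k_2 = \min \min(|A|,|B|)$, where both minima range over all partitions $(A,B)$ of $V(H)$ into two independent sets. Fix $p \in (0,1)$, let $d = 1/(1-p)$, and let $G \sim G(n,p)$. (i) If $k_1 \ge 3$ and $k_2 \ge 2$, then there is a constant $C = C(H,p)$ such that with high probability $$\frac{n}{k_1 - 1} - C\log n \le \chi_H(G) \le \frac{n}{k_1-1} + O\!\left(\frac{n}{\log_d n}\right).$$ (ii) If $k_1 = k_2 = 2$, then there is a constant $C = C(H,p)$ such that with high probability $$n - C\log n \le \chi_H(G) \le n - 2\log_d n + O(\log_d \log n).$$ (iii) In particular, for $H = 2K_2$, with $Q = 1 - 2p^2(1-p)^2$, with high probability $$n - 8\log_{1/Q} n + \Omega(\log_{1/Q}\log n) \le \chi_{2K_2}(G) \le n - 2\log_d n + O(\log_d \log n).$$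
   Context: All graphs are finite and simple. For a fixed bipartite graph $H$, a proper vertex coloring of a graph $G$ is called an $H$-avoiding coloring if for any two color classes, the subgraph of $G$ induced by their union contains no induced subgraph isomorphic to $H$. $\chi_H(G)$ denotes the minimum number of colors in an $H$-avoiding coloring of $G$. $G(n,p)$ is the Erdős–Rényi random graph on $n$ vertices with independent edge probability $p$. "With high probability" means with probability tending to 1 as $n \to \infty$. $\log$ is the natural logarithm and $\log_b$ the logarithm to base $b$. $2K_2$ is the disjoint union of two edges. *)

theory Defs
  imports Complex_Main
begin

text \<open>Graphs on vertex set {0..<n} are given by their edge set, a set of
  2-element subsets of {0..<n}.  The pattern graph H is given by a finite
  vertex set VH and an edge set EH of 2-subsets of VH.\<close>

definition all_edges :: "nat \<Rightarrow> nat set set" where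
  "all_edges n = {e. \<exists>u v. u < n \<and> v < n \<and> u \<noteq> v \<and> e = {u, v}}"

definition simple_graph :: "'b set \<Rightarrow> 'b set set \<Rightarrow> bool" where
  "simple_graph V E \<longleftrightarrow> finite V \<and> E \<subseteq> {e. \<exists>u v. u \<in> V \<and> v \<in> V \<and> u \<noteq> v \<and> e = {u, v}}"

definition gnp_prob :: "nat \<Rightarrow> real \<Rightarrow> (nat set set \<Rightarrow> bool) \<Rightarrow> real" where
  "gnp_prob n p P =
     (\<Sum>E\<in>{E. E \<subseteq> all_edges n \<and> P E}.
        p ^ card E * (1 - p) ^ (card (all_edges n) - card E))"

definition indep_set :: "'b set set \<Rightarrow> 'b set \<Rightarrow> bool" where
  "indep_set E A \<longleftrightarrow> (\<forall>u\<in>A. \<forall>v\<in>A. {u, v} \<notin> E)"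

definition bip_parts :: "'b set \<Rightarrow> 'b set set \<Rightarrow> ('b set \<times> 'b set) set" where
  "bip_parts V E = {(A, B). A \<union> B = V \<and> A \<inter> B = {} \<and> indep_set E A \<and> indep_set E B}"

definition bipartite :: "'b set \<Rightarrow> 'b set set \<Rightarrow> bool" where
  "bipartite V E \<longleftrightarrow> bip_parts V E \<noteq> {}"

definition kH1 :: "'b set \<Rightarrow> 'b set set \<Rightarrow> nat" where
  "kH1 V E = Min ((\<lambda>(A, B). max (card A) (card B)) ` bip_parts V E)"

definition kH2 :: "'b set \<Rightarrow> 'b set set \<Rightarrow> nat" where
  "kH2 V E = Min ((\<lambda>(A, B). min (card A) (card B)) ` bip_parts V E)"

definition has_induced_copy :: "'b set \<Rightarrow> 'b set set \<Rightarrow> nat set set \<Rightarrow> nat set \<Rightarrow> bool" where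
  "has_induced_copy VH EH E S \<longleftrightarrow>
     (\<exists>f. inj_on f VH \<and> f ` VH \<subseteq> S \<and>
          (\<forall>u\<in>VH. \<forall>v\<in>VH. u \<noteq> v \<longrightarrow> ({u, v} \<in> EH \<longleftrightarrow> {f u, f v} \<in> E)))"

definition H_avoiding :: "'b set \<Rightarrow> 'b set set \<Rightarrow> nat \<Rightarrow> nat set set \<Rightarrow> (nat \<Rightarrow> nat) \<Rightarrow> nat \<Rightarrow> bool" where
  "H_avoiding VH EH n E c k \<longleftrightarrow>
     (\<forall>v<n. c v < k) \<and>
     (\<forall>u<n. \<forall>v<n. {u, v} \<in> E \<longrightarrow> c u \<noteq> c v) \<and>
     (\<forall>i j. i \<noteq> j \<longrightarrow> \<not> has_induced_copy VH EH E {v. v < n \<and> (c v = i \<or> c v = j)})"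

definition chiH :: "'b set \<Rightarrow> 'b set set \<Rightarrow> nat \<Rightarrow> nat set set \<Rightarrow> nat" where
  "chiH VH EH n E = (LEAST k. \<exists>c. H_avoiding VH EH n E c k)"

definition V2K2 :: "nat set" where "V2K2 = {0, 1, 2, 3}"
definition E2K2 :: "nat set set" where "E2K2 = {{0, 1}, {2, 3}}"

end

theory Submission
  imports Defs "HOL-Library.Disjoint_Sets" "HOL-Real_Asymp.Real_Asymp"
begin

text \<open>
  Lower bounds: cut the colour classes of an \<open>H\<close>-avoiding colouring into blocks of size \<open>k = k\<^sub>1\<close>,
  leaving fewer than \<open>k\<close> vertices per class. For two blocks the bipartite graph between them contains
  no crossing copy of \<open>H\<close>: in different classes by assumption, in the same class because there are no
  edges at all. Distinct pairs of blocks use disjoint edge sets, so \<open>M\<close> given blocks have this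
  property with probability at most \<open>Q\<close> to the power \<open>M choose 2\<close>, and a union bound over the at most
  \<open>n ^ (k * M) / fact M\<close> families shows that with high probability
  \<open>M \<le> 2 * k * log (1/Q) n - log (1/Q) (ln n)\<close>.

  Upper bounds: classes of size at most \<open>k\<^sub>1 - 1\<close> never span a copy of \<open>H\<close>, and every set of order
  \<open>n / ln n\<close> vertices contains an independent set of size \<open>k\<^sub>1 - 1\<close>, so a greedy colouring works.
  When \<open>k\<^sub>2 \<ge> 2\<close>, one independent set together with singleton classes is \<open>H\<close>-avoiding, and the second
  moment method yields an independent set of size \<open>2 * log d n - O(log d (ln n))\<close>.
\<close>

section \<open>Random edge sets\<close>

definition eweight :: "real \<Rightarrow> 'a set \<Rightarrow> 'a set \<Rightarrow> real" where
  "eweight p F E = p ^ card E * (1 - p) ^ (card F - card E)"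

definition eexp :: "real \<Rightarrow> 'a set \<Rightarrow> ('a set \<Rightarrow> real) \<Rightarrow> real" where
  "eexp p F f = (\<Sum>E\<in>Pow F. eweight p F E * f E)"

definition epr :: "real \<Rightarrow> 'a set \<Rightarrow> ('a set \<Rightarrow> bool) \<Rightarrow> real" where
  "epr p F P = eexp p F (\<lambda>E. of_bool (P E))"

lemma finite_all_edges: "finite (all_edges n)"
proof -
  have "all_edges n \<subseteq> Pow {..<n}" by (auto simp: all_edges_def)
  then show ?thesis using finite_subset by blast
qed

lemma gnp_prob_eq_epr: "gnp_prob n p P = epr p (all_edges n) P"
proof -
  have "epr p (all_edges n) P =
      (\<Sum>E\<in>Pow (all_edges n). if P E then eweight p (all_edges n) E else 0)"
    unfolding epr_def eexp_def by (intro sum.cong) auto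
  also have "\<dots> = (\<Sum>E\<in>{E \<in> Pow (all_edges n). P E}. eweight p (all_edges n) E)"
    by (rule sum.inter_filter[symmetric]) (simp add: finite_all_edges)
  also have "{E \<in> Pow (all_edges n). P E} = {E. E \<subseteq> all_edges n \<and> P E}" by auto
  finally show ?thesis by (simp add: gnp_prob_def eweight_def)
qed

lemma eexp_cong: "(\<And>E. E \<subseteq> F \<Longrightarrow> f E = g E) \<Longrightarrow> eexp p F f = eexp p F g"
  unfolding eexp_def by (intro sum.cong) auto

lemma epr_cong: "(\<And>E. E \<subseteq> F \<Longrightarrow> P E = Q E) \<Longrightarrow> epr p F P = epr p F Q"
  unfolding epr_def by (intro eexp_cong) auto

lemma eexp_Un_disjoint:
  assumes "finite F1" "finite F2" "F1 \<inter> F2 = {}"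
  shows "eexp p (F1 \<union> F2) (\<lambda>E. f (E \<inter> F1) * g (E \<inter> F2)) = eexp p F1 f * eexp p F2 g"
proof -
  have "eexp p F1 f * eexp p F2 g =
      (\<Sum>(A, B)\<in>Pow F1 \<times> Pow F2. (eweight p F1 A * f A) * (eweight p F2 B * g B))"
    unfolding eexp_def by (simp add: sum_product sum.cartesian_product)
  also have "\<dots> = (\<Sum>E\<in>Pow (F1 \<union> F2). eweight p (F1 \<union> F2) E * (f (E \<inter> F1) * g (E \<inter> F2)))"
  proof (rule sum.reindex_bij_witness[where i = "\<lambda>E. (E \<inter> F1, E \<inter> F2)" and j = "\<lambda>(A, B). A \<union> B"], goal_cases)
    case (5 x)
    obtain A B where x: "x = (A, B)" by (cases x)
    have AB: "A \<subseteq> F1" "B \<subseteq> F2" using 5 x by auto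
    have e: "(A \<union> B) \<inter> F1 = A" "(A \<union> B) \<inter> F2 = B" using AB assms(3) by auto
    have fin: "finite A" "finite B" using AB assms finite_subset by blast+
    have c: "card (A \<union> B) = card A + card B" using AB assms fin by (intro card_Un_disjoint) auto
    have c2: "card (F1 \<union> F2) = card F1 + card F2" using assms by (intro card_Un_disjoint) auto
    have "card A \<le> card F1" "card B \<le> card F2" using AB assms by (auto intro: card_mono)
    then have "card F1 + card F2 - (card A + card B) = (card F1 - card A) + (card F2 - card B)" by simp
    then show ?case by (simp add: x e eweight_def c c2 power_add mult_ac)
  qed (use assms(3) in auto)
  finally show ?thesis by (simp add: eexp_def)
qed

lemma eexp_const:
  assumes "finite F"
  shows "eexp p F (\<lambda>_. c) = c"
proof -
  have "eexp p F (\<lambda>_. 1) = 1"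
    using assms
  proof (induction F rule: finite_induct)
    case empty
    show ?case by (simp add: eexp_def eweight_def)
  next
    case (insert x F)
    have "Pow {x} = {{}, {x}}" by auto
    then have "eexp p {x} (\<lambda>_. 1) = 1" by (simp add: eexp_def eweight_def)
    then show ?case
      using eexp_Un_disjoint[of "{x}" F p "\<lambda>_. 1" "\<lambda>_. 1"] insert by simp
  qed
  then have "c * (\<Sum>E\<in>Pow F. eweight p F E) = c" by (simp add: eexp_def)
  then show ?thesis by (simp add: eexp_def sum_distrib_left mult.commute)
qed

lemma eexp_prod_disjoint:
  assumes "finite I" "finite F" "\<And>i. i \<in> I \<Longrightarrow> G i \<subseteq> F"
    and "\<And>i j. i \<in> I \<Longrightarrow> j \<in> I \<Longrightarrow> i \<noteq> j \<Longrightarrow> G i \<inter> G j = {}"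
  shows "eexp p F (\<lambda>E. \<Prod>i\<in>I. f i (E \<inter> G i)) = (\<Prod>i\<in>I. eexp p (G i) (f i))"
  using assms
proof (induction I arbitrary: F rule: finite_induct)
  case empty
  then show ?case by (simp add: eexp_const)
next
  case (insert i I)
  have Gi: "G i \<subseteq> F" using insert.prems by auto
  have sub: "G j \<subseteq> F - G i" if "j \<in> I" for j
    using insert.prems(2)[of j] insert.prems(3)[of i j] that insert.hyps by auto
  have F: "G i \<union> (F - G i) = F" using Gi by auto
  have fin: "finite (G i)" using Gi insert.prems(1) finite_subset by blast
  have "eexp p F (\<lambda>E. \<Prod>j\<in>insert i I. f j (E \<inter> G j)) =
      eexp p (G i \<union> (F - G i)) (\<lambda>E. f i (E \<inter> G i) * (\<Prod>j\<in>I. f j ((E \<inter> (F - G i)) \<inter> G j)))"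
    unfolding F
  proof (intro eexp_cong)
    fix E assume "E \<subseteq> F"
    have "(\<Prod>j\<in>I. f j (E \<inter> G j)) = (\<Prod>j\<in>I. f j ((E \<inter> (F - G i)) \<inter> G j))"
    proof (intro prod.cong refl)
      fix j assume "j \<in> I"
      have "E \<inter> G j = (E \<inter> (F - G i)) \<inter> G j" using sub[OF \<open>j \<in> I\<close>] by auto
      then show "f j (E \<inter> G j) = f j ((E \<inter> (F - G i)) \<inter> G j)" by simp
    qed
    then show "(\<Prod>j\<in>insert i I. f j (E \<inter> G j)) =
        f i (E \<inter> G i) * (\<Prod>j\<in>I. f j ((E \<inter> (F - G i)) \<inter> G j))"
      using insert.hyps by simp
  qed
  also have "\<dots> = eexp p (G i) (f i) * eexp p (F - G i) (\<lambda>E. \<Prod>j\<in>I. f j (E \<inter> G j))"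
    using insert.prems(1) fin
    by (subst eexp_Un_disjoint[where g = "\<lambda>E. \<Prod>j\<in>I. f j (E \<inter> G j)"]) auto
  also have "eexp p (F - G i) (\<lambda>E. \<Prod>j\<in>I. f j (E \<inter> G j)) = (\<Prod>j\<in>I. eexp p (G j) (f j))"
    using insert.prems sub by (intro insert.IH) auto
  finally show ?case using insert.hyps by simp
qed

lemma of_bool_Ball: "finite I \<Longrightarrow> of_bool (\<forall>i\<in>I. P i) = (\<Prod>i\<in>I. of_bool (P i) :: real)"
  by (induction I rule: finite_induct) auto

lemma epr_Ball_disjoint:
  assumes "finite I" "finite F" "\<And>i. i \<in> I \<Longrightarrow> G i \<subseteq> F"
    and "\<And>i j. i \<in> I \<Longrightarrow> j \<in> I \<Longrightarrow> i \<noteq> j \<Longrightarrow> G i \<inter> G j = {}"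
  shows "epr p F (\<lambda>E. \<forall>i\<in>I. P i (E \<inter> G i)) = (\<Prod>i\<in>I. epr p (G i) (P i))"
  unfolding epr_def of_bool_Ball[OF assms(1)]
  using eexp_prod_disjoint[OF assms, where f = "\<lambda>i E. of_bool (P i E)"] by simp

lemma epr_restrict:
  assumes "finite F" "G \<subseteq> F"
  shows "epr p F (\<lambda>E. P (E \<inter> G)) = epr p G P"
  using epr_Ball_disjoint[of "{()}" F "\<lambda>_. G" p "\<lambda>_. P"] assms by simp

lemma eexp_sum: "eexp p F (\<lambda>E. \<Sum>x\<in>X. f x E) = (\<Sum>x\<in>X. eexp p F (f x))"
  unfolding eexp_def by (simp add: sum_distrib_left sum.swap[of _ "Pow F"])

lemma eexp_diff: "eexp p F (\<lambda>E. f E - g E) = eexp p F f - eexp p F g"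
  unfolding eexp_def by (simp add: right_diff_distrib sum_subtractf)

lemma eexp_cmult: "eexp p F (\<lambda>E. c * f E) = c * eexp p F f"
  unfolding eexp_def by (simp add: sum_distrib_left mult_ac)

lemma epr_not: "finite F \<Longrightarrow> epr p F (\<lambda>E. \<not> P E) = 1 - epr p F P"
  using eexp_diff[of p F "\<lambda>_. 1" "\<lambda>E. of_bool (P E)"]
  by (simp add: epr_def eexp_const of_bool_not_iff)

lemma epr_empty:
  assumes "finite F"
  shows "epr p F (\<lambda>E. E = {}) = (1 - p) ^ card F"
proof -
  have "epr p F (\<lambda>E. E = {}) = (\<Sum>E\<in>{{}}. eweight p F E * of_bool (E = {}))"
    unfolding epr_def eexp_def using assms by (intro sum.mono_neutral_right) auto
  then show ?thesis by (simp add: eweight_def)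
qed

context
  fixes p :: real
  assumes p01: "0 < p" "p < 1"
begin

lemma eweight_nonneg: "0 \<le> eweight p F E"
  using p01 by (simp add: eweight_def)

lemma eexp_mono: "(\<And>E. E \<subseteq> F \<Longrightarrow> f E \<le> g E) \<Longrightarrow> eexp p F f \<le> eexp p F g"
  unfolding eexp_def by (intro sum_mono mult_left_mono eweight_nonneg) auto

lemma epr_mono: "(\<And>E. E \<subseteq> F \<Longrightarrow> P E \<Longrightarrow> Q E) \<Longrightarrow> epr p F P \<le> epr p F Q"
  unfolding epr_def by (intro eexp_mono) auto

lemma epr_nonneg: "0 \<le> epr p F P"
  unfolding epr_def eexp_def by (intro sum_nonneg mult_nonneg_nonneg eweight_nonneg) auto

lemma epr_le_1: "finite F \<Longrightarrow> epr p F P \<le> 1"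
  using epr_nonneg[of F "\<lambda>E. \<not> P E"] epr_not[of F p P] by simp

lemma epr_Bex_le:
  assumes "finite X"
  shows "epr p F (\<lambda>E. \<exists>x\<in>X. P x E) \<le> (\<Sum>x\<in>X. epr p F (P x))"
proof -
  have "of_bool (\<exists>x\<in>X. P x E) \<le> (\<Sum>x\<in>X. of_bool (P x E) :: real)" for E
  proof (cases "\<exists>x\<in>X. P x E")
    case True
    then obtain x where x: "x \<in> X" "P x E" by auto
    have "(of_bool (P x E) :: real) \<le> (\<Sum>x\<in>X. of_bool (P x E))"
      by (rule member_le_sum) (use x assms in auto)
    then show ?thesis using True x by simp
  qed (auto intro: sum_nonneg)
  then show ?thesis
    unfolding epr_def eexp_sum[symmetric] by (intro eexp_mono) simp
qed

lemma epr_disj_le: "epr p F (\<lambda>E. P E \<or> Q E) \<le> epr p F P + epr p F Q"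
proof -
  have "epr p F P + epr p F Q = eexp p F (\<lambda>E. of_bool (P E) + of_bool (Q E))"
    by (simp add: epr_def eexp_def sum.distrib distrib_left)
  then show ?thesis
    unfolding epr_def[of p F "\<lambda>E. P E \<or> Q E"] by (simp only:) (intro eexp_mono, auto)
qed

lemma epr_zero_le_second_moment:
  assumes "finite F" "eexp p F X > 0"
  shows "epr p F (\<lambda>E. X E = 0) \<le> eexp p F (\<lambda>E. X E * X E) / (eexp p F X)\<^sup>2 - 1"
proof -
  define m where "m = eexp p F X"
  have "m\<^sup>2 * epr p F (\<lambda>E. X E = 0) = eexp p F (\<lambda>E. m\<^sup>2 * of_bool (X E = 0))"
    by (simp add: epr_def eexp_cmult)
  also have "\<dots> \<le> eexp p F (\<lambda>E. (X E * X E - 2 * m * X E) - (- m\<^sup>2))"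
  proof (intro eexp_mono)
    fix E
    have "0 \<le> (X E - m)\<^sup>2" by simp
    then show "m\<^sup>2 * of_bool (X E = 0) \<le> (X E * X E - 2 * m * X E) - (- m\<^sup>2)"
      by (cases "X E = 0") (simp_all add: power2_eq_square algebra_simps)
  qed
  also have "\<dots> = eexp p F (\<lambda>E. X E * X E) - 2 * m * m + m\<^sup>2"
    using assms(1) by (simp only: eexp_diff eexp_cmult eexp_const m_def)
  finally have "epr p F (\<lambda>E. X E = 0) * m\<^sup>2 \<le> eexp p F (\<lambda>E. X E * X E) - m\<^sup>2"
    by (simp add: power2_eq_square algebra_simps)
  moreover have "m\<^sup>2 > 0" using assms(2) by (simp add: m_def)
  ultimately have "epr p F (\<lambda>E. X E = 0) \<le> (eexp p F (\<lambda>E. X E * X E) - m\<^sup>2) / m\<^sup>2"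
    by (simp add: pos_le_divide_eq)
  then show ?thesis using \<open>m\<^sup>2 > 0\<close> by (simp add: m_def[symmetric] diff_divide_distrib)
qed

end

lemma epr_tendsto_1I:
  fixes p :: real
  assumes p: "0 < p" "p < 1"
    and B1: "(\<lambda>n. gnp_prob n p (B1 n)) \<longlonglongrightarrow> 0"
    and B2: "(\<lambda>n. gnp_prob n p (B2 n)) \<longlonglongrightarrow> 0"
    and P: "eventually (\<lambda>n. \<forall>E \<subseteq> all_edges n. \<not> B1 n E \<longrightarrow> \<not> B2 n E \<longrightarrow> P n E) sequentially"
  shows "(\<lambda>n. gnp_prob n p (P n)) \<longlonglongrightarrow> 1"
proof (rule tendsto_sandwich[OF _ _ _ tendsto_const])
  show "(\<lambda>n. 1 - (gnp_prob n p (B1 n) + gnp_prob n p (B2 n))) \<longlonglongrightarrow> 1"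
    using tendsto_diff[OF tendsto_const[of 1] tendsto_add[OF B1 B2]] by simp
  show "\<forall>\<^sub>F n in sequentially. gnp_prob n p (P n) \<le> 1"
    by (simp add: gnp_prob_eq_epr epr_le_1[OF p] finite_all_edges)
  show "\<forall>\<^sub>F n in sequentially. 1 - (gnp_prob n p (B1 n) + gnp_prob n p (B2 n)) \<le> gnp_prob n p (P n)"
    using P
  proof eventually_elim
    case (elim n)
    have "epr p (all_edges n) (\<lambda>E. \<not> P n E) \<le> epr p (all_edges n) (\<lambda>E. B1 n E \<or> B2 n E)"
      using elim by (intro epr_mono[OF p]) blast
    also have "\<dots> \<le> epr p (all_edges n) (B1 n) + epr p (all_edges n) (B2 n)"
      by (rule epr_disj_le[OF p])
    finally show ?case by (simp add: gnp_prob_eq_epr epr_not finite_all_edges)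
  qed
qed

section \<open>Induced copies and bipartitions\<close>

definition pairs :: "'a set \<Rightarrow> 'a set set" where
  "pairs S = {e. e \<subseteq> S \<and> card e = 2}"

lemma all_edges_eq_pairs: "all_edges n = pairs {..<n}"
  by (auto simp: all_edges_def pairs_def card_2_iff)

lemma card_pairs: "finite S \<Longrightarrow> card (pairs S) = card S choose 2"
  unfolding pairs_def by (rule n_subsets)

lemma finite_pairs: "finite S \<Longrightarrow> finite (pairs S)"
  unfolding pairs_def by simp

lemma pairs_mono: "S \<subseteq> T \<Longrightarrow> pairs S \<subseteq> pairs T"
  by (auto simp: pairs_def)

lemma indep_set_iff_pairs:
  assumes "E \<subseteq> all_edges n"
  shows "indep_set E S \<longleftrightarrow> E \<inter> pairs S = {}"
proof
  assume "indep_set E S"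
  then show "E \<inter> pairs S = {}" by (auto simp: indep_set_def pairs_def card_2_iff)
next
  assume disj: "E \<inter> pairs S = {}"
  show "indep_set E S"
    unfolding indep_set_def
  proof (intro ballI notI)
    fix u v assume uv: "u \<in> S" "v \<in> S" "{u, v} \<in> E"
    then have "u \<noteq> v" using assms by (auto simp: all_edges_def)
    then have "{u, v} \<in> pairs S" using uv by (simp add: pairs_def)
    then show False using uv disj by blast
  qed
qed

lemma indep_set_card_le_1:
  assumes "E \<subseteq> all_edges n" "finite S" "card S \<le> 1"
  shows "indep_set E S"
  unfolding indep_set_def
proof (intro ballI)
  fix u v assume "u \<in> S" "v \<in> S"
  then have "u = v" using assms(2,3) card_le_Suc0_iff_eq[of S] by simp
  then show "{u, v} \<notin> E" using assms(1) by (auto simp: all_edges_def)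
qed

lemma induced_copy_bip_parts:
  assumes "has_induced_copy V H E (S \<union> T)" "simple_graph V H"
    and "S \<inter> T = {}" "indep_set E S" "indep_set E T" "finite S" "finite T"
  obtains A B where "(A, B) \<in> bip_parts V H" "card A \<le> card S" "card B \<le> card T"
proof -
  obtain f where f: "inj_on f V" "f ` V \<subseteq> S \<union> T"
    and e: "\<And>u v. u \<in> V \<Longrightarrow> v \<in> V \<Longrightarrow> u \<noteq> v \<Longrightarrow> {u, v} \<in> H \<longleftrightarrow> {f u, f v} \<in> E"
    using assms(1) unfolding has_induced_copy_def by blast
  have nl: "{u, u} \<notin> H" for u
    using assms(2) by (fastforce simp: simple_graph_def doubleton_eq_iff)
  have ind: "indep_set H {u \<in> V. f u \<in> W}" if "indep_set E W" for W
    unfolding indep_set_def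
  proof (intro ballI)
    fix u v assume uv: "u \<in> {u \<in> V. f u \<in> W}" "v \<in> {u \<in> V. f u \<in> W}"
    then have "{f u, f v} \<notin> E" using that by (auto simp: indep_set_def)
    then show "{u, v} \<notin> H" using e[of u v] uv nl[of u] by (cases "u = v") auto
  qed
  have card: "card {u \<in> V. f u \<in> W} \<le> card W" if "finite W" for W
    by (rule card_inj_on_le[of f]) (use f that in \<open>auto intro: inj_on_subset\<close>)
  have "({u \<in> V. f u \<in> S}, {u \<in> V. f u \<in> T}) \<in> bip_parts V H"
    using f(2) assms(3) ind[OF assms(4)] ind[OF assms(5)] by (auto simp: bip_parts_def)
  then show ?thesis using that card assms by blast
qed

lemma finite_bip_parts: "finite V \<Longrightarrow> finite (bip_parts V H)"
  by (rule finite_subset[of _ "Pow V \<times> Pow V"]) (auto simp: bip_parts_def)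

lemma kH1_le:
  assumes "simple_graph V H" "(A, B) \<in> bip_parts V H"
  shows "kH1 V H \<le> max (card A) (card B)"
proof -
  have "max (card A) (card B) \<in> (\<lambda>(A, B). max (card A) (card B)) ` bip_parts V H"
    using assms(2) by (intro rev_image_eqI[where x = "(A, B)"]) auto
  moreover have "finite (bip_parts V H)"
    using assms(1) by (simp add: simple_graph_def finite_bip_parts)
  ultimately show ?thesis unfolding kH1_def by (intro Min_le) auto
qed

lemma kH2_le:
  assumes "simple_graph V H" "(A, B) \<in> bip_parts V H"
  shows "kH2 V H \<le> min (card A) (card B)"
proof -
  have "min (card A) (card B) \<in> (\<lambda>(A, B). min (card A) (card B)) ` bip_parts V H"
    using assms(2) by (intro rev_image_eqI[where x = "(A, B)"]) auto
  moreover have "finite (bip_parts V H)"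
    using assms(1) by (simp add: simple_graph_def finite_bip_parts)
  ultimately show ?thesis unfolding kH2_def by (intro Min_le) auto
qed

lemma kH1_attained:
  assumes "simple_graph V H" "bipartite V H"
  obtains A B where "(A, B) \<in> bip_parts V H" "max (card A) (card B) = kH1 V H"
proof -
  have "kH1 V H \<in> (\<lambda>(A, B). max (card A) (card B)) ` bip_parts V H"
    unfolding kH1_def
    by (rule Min_in) (use assms in \<open>auto simp: simple_graph_def finite_bip_parts bipartite_def\<close>)
  then show ?thesis using that by auto
qed

lemma has_edge_if_bip_parts_nonempty:
  assumes "simple_graph V H" "\<And>A B. (A, B) \<in> bip_parts V H \<Longrightarrow> A \<noteq> {} \<and> B \<noteq> {}"
  shows "H \<noteq> {}"
proof
  assume "H = {}"
  then have "(V, {}) \<in> bip_parts V H" by (auto simp: bip_parts_def indep_set_def)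
  then show False using assms(2) by blast
qed

section \<open>Colourings\<close>

lemma H_avoidingI:
  assumes "simple_graph V H" "E \<subseteq> all_edges n"
    and "\<And>v. v < n \<Longrightarrow> c v < k"
    and "\<And>i. indep_set E {v. v < n \<and> c v = i}"
    and "\<And>i j A B. i \<noteq> j \<Longrightarrow> (A, B) \<in> bip_parts V H \<Longrightarrow> card A \<le> card {v. v < n \<and> c v = i} \<Longrightarrow>
           card B \<le> card {v. v < n \<and> c v = j} \<Longrightarrow> False"
  shows "H_avoiding V H n E c k"
  unfolding H_avoiding_def
proof (intro conjI allI impI)
  fix u v assume "u < n" "v < n" "{u, v} \<in> E"
  then show "c u \<noteq> c v" using assms(4)[of "c u"] by (auto simp: indep_set_def)
next
  fix i j :: nat assume ij: "i \<noteq> j"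
  have eq: "{v. v < n \<and> (c v = i \<or> c v = j)} = {v. v < n \<and> c v = i} \<union> {v. v < n \<and> c v = j}" by auto
  show "\<not> has_induced_copy V H E {v. v < n \<and> (c v = i \<or> c v = j)}"
  proof
    assume "has_induced_copy V H E {v. v < n \<and> (c v = i \<or> c v = j)}"
    then have "has_induced_copy V H E ({v. v < n \<and> c v = i} \<union> {v. v < n \<and> c v = j})"
      by (simp only: eq)
    then obtain A B where "(A, B) \<in> bip_parts V H" "card A \<le> card {v. v < n \<and> c v = i}"
        "card B \<le> card {v. v < n \<and> c v = j}"
      by (rule induced_copy_bip_parts[OF _ assms(1) _ assms(4) assms(4)]) (use ij in auto)
    then show False using assms(5) ij by blast
  qed
qed (use assms(3) in auto)

lemma chiH_le: "H_avoiding V H n E c k \<Longrightarrow> chiH V H n E \<le> k"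
  unfolding chiH_def by (rule Least_le) blast

lemma chiH_attained:
  assumes "simple_graph V H" "E \<subseteq> all_edges n"
    and "\<And>A B. (A, B) \<in> bip_parts V H \<Longrightarrow> 2 \<le> card A \<and> 2 \<le> card B"
  obtains c where "H_avoiding V H n E c (chiH V H n E)"
proof -
  have le: "card {v. v < n \<and> id v = i} \<le> 1" for i :: nat
    by (rule order.trans[OF card_mono[of "{i}"]]) auto
  have "H_avoiding V H n E id n"
  proof (rule H_avoidingI[OF assms(1,2)])
    show "indep_set E {v. v < n \<and> id v = i}" for i
      using assms(2) by (auto simp: indep_set_def all_edges_def)
    show False if "(A, B) \<in> bip_parts V H" "card A \<le> card {v. v < n \<and> id v = i}" for A B i
      using assms(3)[OF that(1)] that(2) le[of i] by linarith
  qed auto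
  then have "\<exists>k c. H_avoiding V H n E c k" by blast
  from LeastI_ex[OF this] show ?thesis using that unfolding chiH_def by blast
qed

lemma chiH_le_indep_set:
  assumes "simple_graph V H" "E \<subseteq> all_edges n"
    and "\<And>A B. (A, B) \<in> bip_parts V H \<Longrightarrow> 2 \<le> card A \<and> 2 \<le> card B"
    and "S \<subseteq> {..<n}" "indep_set E S"
  shows "chiH V H n E \<le> n - card S + 1"
proof -
  have fin: "finite S" using assms(4) finite_subset by blast
  have card: "card ({..<n} - S) = n - card S" using assms(4) fin by (simp add: card_Diff_subset)
  then obtain g where g: "bij_betw g ({..<n} - S) {0..<n - card S}"
    using ex_bij_betw_finite_nat[of "{..<n} - S"] by auto
  define c where "c v = (if v \<in> S then n - card S else g v)" for v
  have glt: "g v < n - card S" if "v < n" "v \<notin> S" for v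
    using bij_betwE[OF g] that by auto
  have cls_eq: "{v. v < n \<and> c v = n - card S} = S"
    using assms(4) glt by (force simp: c_def)
  have cls: "card {v. v < n \<and> c v = i} \<le> 1" if "i \<noteq> n - card S" for i
  proof -
    have "card {v. v < n \<and> c v = i} \<le> card {i}"
    proof (rule card_inj_on_le[of g])
      have "{v. v < n \<and> c v = i} \<subseteq> {..<n} - S" using that by (auto simp: c_def)
      then show "inj_on g {v. v < n \<and> c v = i}"
        by (rule inj_on_subset[OF bij_betw_imp_inj_on[OF g]])
      show "g ` {v. v < n \<and> c v = i} \<subseteq> {i}" using that by (auto simp: c_def split: if_splits)
    qed auto
    then show ?thesis by simp
  qed
  have "H_avoiding V H n E c (n - card S + 1)"
  proof (rule H_avoidingI[OF assms(1,2)])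
    show "c v < n - card S + 1" if "v < n" for v using glt[OF that] by (auto simp: c_def)
    show "indep_set E {v. v < n \<and> c v = i}" for i
    proof (cases "i = n - card S")
      case True
      then show ?thesis using cls_eq assms(5) by simp
    next
      case False
      then show ?thesis using cls by (intro indep_set_card_le_1[OF assms(2)]) auto
    qed
    show False if "i \<noteq> j" "(A, B) \<in> bip_parts V H" "card A \<le> card {v. v < n \<and> c v = i}"
      "card B \<le> card {v. v < n \<and> c v = j}" for A B i j
      using assms(3)[OF that(2)] that cls[of i] cls[of j] by force
  qed
  then show ?thesis by (rule chiH_le)
qed

text \<open>Independent \<open>r\<close>-sets are removed greedily; the last fewer than \<open>m\<close> vertices become singletons.\<close>

lemma greedy_small_classes:
  assumes "r > 0" "E \<subseteq> all_edges n"
    and ind: "\<And>W. W \<subseteq> {..<n} \<Longrightarrow> card W = m \<Longrightarrow> \<exists>T\<subseteq>W. card T = r \<and> indep_set E T"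
    and "S \<subseteq> {..<n}"
  shows "\<exists>c k. (\<forall>v\<in>S. c v < k) \<and> (\<forall>i. indep_set E {v \<in> S. c v = i}) \<and>
           (\<forall>i. card {v \<in> S. c v = i} \<le> r) \<and> r * k \<le> card S + r * m"
  using assms(4)
proof (induction "card S" arbitrary: S rule: less_induct)
  case less
  have fin: "finite S" using less.prems finite_subset by blast
  show ?case
  proof (cases "card S < m")
    case True
    obtain g where g: "bij_betw g S {0..<card S}" using ex_bij_betw_finite_nat[OF fin] by blast
    have le: "card {v \<in> S. g v = i} \<le> 1" for i
    proof -
      have "inj_on g {v \<in> S. g v = i}"
        by (rule inj_on_subset[OF bij_betw_imp_inj_on[OF g]]) auto
      then show ?thesis using card_inj_on_le[of g _ "{i}"] by auto
    qed
    have "indep_set E {v \<in> S. g v = i}" for i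
      using fin le by (intro indep_set_card_le_1[OF assms(2)]) auto
    moreover have "card {v \<in> S. g v = i} \<le> r" for i
      using le[of i] assms(1) by simp
    moreover have "\<forall>v\<in>S. g v < card S" using bij_betwE[OF g] by auto
    moreover have "r * card S \<le> card S + r * m" using True by (simp add: trans_le_add2)
    ultimately show ?thesis by blast
  next
    case False
    then obtain W where W: "W \<subseteq> S" "card W = m" by (meson leI obtain_subset_with_card_n)
    then obtain T where T: "T \<subseteq> W" "card T = r" "indep_set E T" using ind less.prems by blast
    then have TS: "T \<subseteq> S" using W by blast
    have finT: "finite T" using TS fin finite_subset by blast
    have cT: "card (S - T) = card S - r" using T TS finT by (simp add: card_Diff_subset)
    have rS: "r \<le> card S" using T(2) TS fin card_mono by blast
    have lt: "card (S - T) < card S" using cT rS assms(1) by linarith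
    obtain c k where c: "\<forall>v\<in>S-T. c v < k" "\<And>i. indep_set E {v \<in> S - T. c v = i}"
        "\<And>i. card {v \<in> S - T. c v = i} \<le> r" "r * k \<le> card (S - T) + r * m"
      using less.hyps[OF lt] less.prems by blast
    define c' where "c' v = (if v \<in> T then k else c v)" for v
    have k: "{v \<in> S. c' v = k} = T" using TS c(1) by (auto simp: c'_def)
    have nk: "{v \<in> S. c' v = i} = {v \<in> S - T. c v = i}" if "i \<noteq> k" for i
      using that by (auto simp: c'_def)
    have "\<forall>v\<in>S. c' v < Suc k" using c(1) by (auto simp: c'_def less_Suc_eq)
    moreover have "indep_set E {v \<in> S. c' v = i}" for i
      using k nk[of i] c(2)[of i] T(3) by (cases "i = k") auto
    moreover have "card {v \<in> S. c' v = i} \<le> r" for i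
      using k nk[of i] c(3)[of i] T(2) by (cases "i = k") auto
    moreover have "r * Suc k \<le> card S + r * m" using c(4) cT rS by simp
    ultimately show ?thesis by blast
  qed
qed

lemma chiH_le_greedy:
  assumes "simple_graph V H" "E \<subseteq> all_edges n" "kH1 V H \<ge> 2"
    and "\<And>W. W \<subseteq> {..<n} \<Longrightarrow> card W = m \<Longrightarrow> \<exists>T\<subseteq>W. card T = kH1 V H - 1 \<and> indep_set E T"
  shows "(kH1 V H - 1) * chiH V H n E \<le> n + (kH1 V H - 1) * m"
proof -
  define r where "r = kH1 V H - 1"
  have r: "r > 0" "r < kH1 V H" using assms(3) by (auto simp: r_def)
  obtain c k where c: "\<forall>v\<in>{..<n}. c v < k" "\<And>i. indep_set E {v \<in> {..<n}. c v = i}"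
        "\<And>i. card {v \<in> {..<n}. c v = i} \<le> r" "r * k \<le> card {..<n} + r * m"
    using greedy_small_classes[OF r(1) assms(2) assms(4)[folded r_def] subset_refl] by blast
  have "H_avoiding V H n E c k"
  proof (rule H_avoidingI[OF assms(1,2)])
    show False if "(A, B) \<in> bip_parts V H" "card A \<le> card {v. v < n \<and> c v = i}"
        "card B \<le> card {v. v < n \<and> c v = j}" for A B i j
      using kH1_le[OF assms(1) that(1)] that c(3)[of i] c(3)[of j] r(2) by auto
  qed (use c in auto)
  then have "r * chiH V H n E \<le> r * k" using chiH_le by (intro mult_left_mono) auto
  also have "\<dots> \<le> n + r * m" using c(4) by simp
  finally show ?thesis by (simp only: r_def)
qed

section \<open>Block families without crossing copies\<close>

definition cross :: "'a set set \<Rightarrow> 'a set set" where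
  "cross X = {e. \<exists>S\<in>X. \<exists>T\<in>X. S \<noteq> T \<and> (\<exists>x\<in>S. \<exists>y\<in>T. e = {x, y})}"

lemma cross_pair: "S \<noteq> T \<Longrightarrow> cross {S, T} = (\<lambda>(x, y). {x, y}) ` (S \<times> T)"
  by (auto simp: cross_def insert_commute)

lemma cross_determines_blocks:
  assumes "disjoint \<S>" "X \<in> pairs \<S>" "e \<in> cross X"
  shows "X = {S \<in> \<S>. S \<inter> e \<noteq> {}}"
proof -
  obtain S T x y where ST: "S \<in> X" "T \<in> X" "S \<noteq> T" "x \<in> S" "y \<in> T" "e = {x, y}"
    using assms(3) by (auto simp: cross_def)
  have X: "X = {S, T}" using assms(2) ST by (auto simp: pairs_def card_2_iff)
  have "U = S \<or> U = T" if "U \<in> \<S>" "U \<inter> e \<noteq> {}" for U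
    using that ST X assms(1,2) by (auto simp: pairs_def dest: disjointD)
  then show ?thesis using ST X assms(2) by (auto simp: pairs_def)
qed

lemma cross_subset_all_edges:
  assumes "disjoint \<S>" "X \<in> pairs \<S>" "\<And>S. S \<in> \<S> \<Longrightarrow> S \<subseteq> {..<n}"
  shows "cross X \<subseteq> all_edges n"
proof
  fix e assume "e \<in> cross X"
  then obtain S T x y where ST: "S \<in> X" "T \<in> X" "S \<noteq> T" "x \<in> S" "y \<in> T" "e = {x, y}"
    by (auto simp: cross_def)
  moreover have "S \<in> \<S>" "T \<in> \<S>" using ST assms(2) by (auto simp: pairs_def)
  moreover have "S \<inter> T = {}" using calculation assms(1) by (auto dest: disjointD)
  ultimately show "e \<in> all_edges n" using assms(3)[of S] assms(3)[of T]
    unfolding all_edges_def by blast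
qed

definition copy_free_family :: "'b set \<Rightarrow> 'b set set \<Rightarrow> nat set set \<Rightarrow> nat set set \<Rightarrow> bool" where
  "copy_free_family V H E \<S> \<longleftrightarrow>
     (\<forall>X\<in>pairs \<S>. \<not> has_induced_copy V H (E \<inter> cross X) (\<Union>X))"

definition block_family :: "nat \<Rightarrow> nat \<Rightarrow> nat \<Rightarrow> nat set set \<Rightarrow> bool" where
  "block_family n k M \<S> \<longleftrightarrow>
     \<S> \<subseteq> {S. S \<subseteq> {..<n} \<and> card S = k} \<and> card \<S> = M \<and> disjoint \<S>"

lemma epr_copy_free_family_le:
  fixes p Q :: real
  assumes p: "0 < p" "p < 1" and k: "k > 0"
    and Q: "\<And>S T. finite S \<Longrightarrow> finite T \<Longrightarrow> card S = k \<Longrightarrow> card T = k \<Longrightarrow> S \<inter> T = {} \<Longrightarrow>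
              epr p (cross {S, T}) (\<lambda>E. \<not> has_induced_copy V H E (S \<union> T)) \<le> Q"
    and \<S>: "block_family n k M \<S>"
  shows "epr p (all_edges n) (\<lambda>E. copy_free_family V H E \<S>) \<le> Q ^ (M choose 2)"
proof -
  have sub: "\<S> \<subseteq> Pow {..<n}" and card: "card \<S> = M" and disj: "disjoint \<S>"
    and c: "\<And>S. S \<in> \<S> \<Longrightarrow> card S = k" and Sn: "\<And>S. S \<in> \<S> \<Longrightarrow> S \<subseteq> {..<n}"
    using \<S> unfolding block_family_def by auto
  have fin: "finite \<S>" using sub finite_subset by blast
  have "epr p (all_edges n) (\<lambda>E. copy_free_family V H E \<S>) =
      (\<Prod>X\<in>pairs \<S>. epr p (cross X) (\<lambda>E. \<not> has_induced_copy V H E (\<Union>X)))"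
    unfolding copy_free_family_def
  proof (rule epr_Ball_disjoint)
    show "finite (pairs \<S>)" using fin by (rule finite_pairs)
    show "cross X \<inter> cross Y = {}" if "X \<in> pairs \<S>" "Y \<in> pairs \<S>" "X \<noteq> Y" for X Y
    proof (rule ccontr)
      assume "cross X \<inter> cross Y \<noteq> {}"
      then obtain e where e: "e \<in> cross X" "e \<in> cross Y" by blast
      show False
        using cross_determines_blocks[OF disj that(1) e(1)]
          cross_determines_blocks[OF disj that(2) e(2)] that(3) by simp
    qed
    show "cross X \<subseteq> all_edges n" if "X \<in> pairs \<S>" for X
      using cross_subset_all_edges[OF disj that Sn] .
  qed (rule finite_all_edges)
  also have "\<dots> \<le> (\<Prod>X\<in>pairs \<S>. Q)"
  proof (intro prod_mono conjI)
    fix X assume X: "X \<in> pairs \<S>"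
    then obtain S T where ST: "X = {S, T}" "S \<noteq> T" by (auto simp: pairs_def card_2_iff)
    then have mem: "S \<in> \<S>" "T \<in> \<S>" using X by (auto simp: pairs_def)
    have "epr p (cross {S, T}) (\<lambda>E. \<not> has_induced_copy V H E (S \<union> T)) \<le> Q"
    proof (rule Q)
      show "finite S" "finite T" using Sn[OF mem(1)] Sn[OF mem(2)] finite_subset by blast+
      show "S \<inter> T = {}" using disjointD[OF disj mem] ST(2) by blast
    qed (use c mem in simp_all)
    then show "epr p (cross X) (\<lambda>E. \<not> has_induced_copy V H E (\<Union>X)) \<le> Q" by (simp add: ST)
  qed (rule epr_nonneg[OF p])
  also have "\<dots> = Q ^ (M choose 2)" by (simp add: card_pairs fin card)
  finally show ?thesis .
qed

lemma epr_ex_copy_free_family_le: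
  fixes p Q :: real
  assumes p: "0 < p" "p < 1" and k: "k > 0"
    and Q: "\<And>S T. finite S \<Longrightarrow> finite T \<Longrightarrow> card S = k \<Longrightarrow> card T = k \<Longrightarrow> S \<inter> T = {} \<Longrightarrow>
              epr p (cross {S, T}) (\<lambda>E. \<not> has_induced_copy V H E (S \<union> T)) \<le> Q"
  shows "epr p (all_edges n) (\<lambda>E. \<exists>\<S>. block_family n k M \<S> \<and> copy_free_family V H E \<S>)
           \<le> real ((n choose k) choose M) * Q ^ (M choose 2)"
proof -
  define \<B> where "\<B> = Collect (block_family n k M)"
  define \<K> where "\<K> = {S. S \<subseteq> {..<n} \<and> card S = k}"
  have finK: "finite \<K>" unfolding \<K>_def by simp
  have cK: "card \<K> = n choose k" unfolding \<K>_def using n_subsets[of "{..<n}" k] by simp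
  have sub: "\<B> \<subseteq> {\<S>. \<S> \<subseteq> \<K> \<and> card \<S> = M}" 
    unfolding \<B>_def \<K>_def block_family_def by blast
  have fin2: "finite {\<S>. \<S> \<subseteq> \<K> \<and> card \<S> = M}" using finK by simp
  have finB: "finite \<B>" using sub fin2 finite_subset by blast
  have cB: "card \<B> \<le> (n choose k) choose M"
    using card_mono[OF fin2 sub] n_subsets[OF finK, of M] cK by simp
  have Q0: "0 \<le> Q"
  proof -
    have "0 \<le> epr p (cross {{..<k}, {k..<2*k}}) (\<lambda>E. \<not> has_induced_copy V H E ({..<k} \<union> {k..<2*k}))"
      by (rule epr_nonneg[OF p])
    also have "\<dots> \<le> Q" by (rule Q) auto
    finally show ?thesis .
  qed
  have "epr p (all_edges n) (\<lambda>E. \<exists>\<S>. block_family n k M \<S> \<and> copy_free_family V H E \<S>) =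
      epr p (all_edges n) (\<lambda>E. \<exists>\<S>\<in>\<B>. copy_free_family V H E \<S>)"
    by (simp add: \<B>_def Bex_def)
  also have "\<dots> \<le> (\<Sum>\<S>\<in>\<B>. epr p (all_edges n) (\<lambda>E. copy_free_family V H E \<S>))"
    by (rule epr_Bex_le[OF p finB])
  also have "\<dots> \<le> (\<Sum>\<S>\<in>\<B>. Q ^ (M choose 2))"
    by (intro sum_mono epr_copy_free_family_le[OF p k Q]) (auto simp: \<B>_def)
  also have "\<dots> = real (card \<B>) * Q ^ (M choose 2)" by simp
  also have "\<dots> \<le> real ((n choose k) choose M) * Q ^ (M choose 2)"
    using cB Q0 by (intro mult_right_mono) auto
  finally show ?thesis .
qed

section \<open>From colourings to block families\<close>

lemma split_into_blocks:
  assumes "finite C" "k > 0" "q * k \<le> card C"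
  shows "\<exists>\<S>. card \<S> = q \<and> finite \<S> \<and> disjoint \<S> \<and> (\<forall>S\<in>\<S>. S \<subseteq> C \<and> card S = k)"
  using assms(1,3)
proof (induction q arbitrary: C)
  case 0
  show ?case by (rule exI[of _ "{}"]) simp
next
  case (Suc q)
  have "k \<le> card C" using Suc.prems by simp
  then obtain W where W: "W \<subseteq> C" "card W = k" by (meson obtain_subset_with_card_n)
  have finW: "finite W" using W(1) Suc.prems(1) by (rule finite_subset)
  have "q * k \<le> card (C - W)" using Suc.prems W finW by (simp add: card_Diff_subset)
  then obtain \<S> where \<S>: "card \<S> = q" "finite \<S>" "disjoint \<S>" "\<forall>S\<in>\<S>. S \<subseteq> C - W \<and> card S = k"
    using Suc.IH[of "C - W"] Suc.prems(1) by auto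
  have "W \<noteq> {}" using W(2) assms(2) by auto
  then have nW: "W \<notin> \<S>" using \<S>(4) by blast
  have "disjoint (insert W \<S>)"
    using \<S>(3,4) unfolding disjoint_def pairwise_insert disjnt_def by blast
  then show ?case using \<S> nW W by (intro exI[of _ "insert W \<S>"]) auto
qed

lemma has_induced_copy_mono:
  "has_induced_copy V H E S \<Longrightarrow> S \<subseteq> T \<Longrightarrow> has_induced_copy V H E T"
  unfolding has_induced_copy_def by blast

lemma no_induced_copy_in_empty_graph:
  assumes "simple_graph V H" "H \<noteq> {}"
  shows "\<not> has_induced_copy V H {} S"
proof -
  obtain u v where "u \<in> V" "v \<in> V" "u \<noteq> v" "{u, v} \<in> H"
    using assms unfolding simple_graph_def by blast
  then show ?thesis unfolding has_induced_copy_def by blast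
qed

lemma has_induced_copy_cross:
  assumes "has_induced_copy V H (E \<inter> cross {S, T}) (S \<union> T)" "S \<noteq> T" "indep_set E S" "indep_set E T"
  shows "has_induced_copy V H E (S \<union> T)"
proof -
  have "{x, y} \<in> E \<inter> cross {S, T} \<longleftrightarrow> {x, y} \<in> E" if "x \<in> S \<union> T" "y \<in> S \<union> T" for x y
    using that assms(2-4) unfolding indep_set_def cross_def by blast
  then show ?thesis
    using assms(1) unfolding has_induced_copy_def
    by (elim exE conjE, intro exI conjI) (assumption, assumption, simp add: image_subset_iff)
qed

lemma H_avoiding_card_le:
  assumes H: "simple_graph V H" "H \<noteq> {}" and E: "E \<subseteq> all_edges n"
    and c: "H_avoiding V H n E c t" and k: "k > 0"
    and M: "\<nexists>\<S>. block_family n k M \<S> \<and> copy_free_family V H E \<S>"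
  shows "M > 0" and "n \<le> (k - 1) * t + k * (M - 1)"
proof -
  define C where "C i = {v. v < n \<and> c v = i}" for i
  have finC: "finite (C i)" for i by (simp add: C_def)
  have indC: "indep_set E (C i)" for i
    unfolding indep_set_def
  proof (intro ballI notI)
    fix u v assume "u \<in> C i" "v \<in> C i" "{u, v} \<in> E"
    then have uv: "u < n" "v < n" "c u = c v" "{u, v} \<in> E" by (simp_all add: C_def)
    have "\<forall>u<n. \<forall>v<n. {u, v} \<in> E \<longrightarrow> c u \<noteq> c v" using c by (simp add: H_avoiding_def)
    then show False using uv by blast
  qed
  have copy: "\<not> has_induced_copy V H E (C i \<union> C j)" if "i \<noteq> j" for i j
  proof -
    have "C i \<union> C j = {v. v < n \<and> (c v = i \<or> c v = j)}" by (auto simp: C_def)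
    then show ?thesis using c that by (simp add: H_avoiding_def)
  qed
  have "\<exists>\<S>. card \<S> = card (C i) div k \<and> finite \<S> \<and> disjoint \<S> \<and> (\<forall>S\<in>\<S>. S \<subseteq> C i \<and> card S = k)" for i
    by (rule split_into_blocks[OF finC k]) simp
  then obtain B where B: "\<And>i. card (B i) = card (C i) div k" "\<And>i. finite (B i)" "\<And>i. disjoint (B i)"
      "\<And>i S. S \<in> B i \<Longrightarrow> S \<subseteq> C i \<and> card S = k"
    by metis
  define \<T> where "\<T> = (\<Union>i<t. B i)"
  have ne: "S \<noteq> {}" if "S \<in> B i" for S i using B(4)[OF that] k by auto
  have across: "S \<inter> T = {}" if "S \<in> B i" "T \<in> B j" "i \<noteq> j" for S T i j
    using B(4)[OF that(1)] B(4)[OF that(2)] that(3) by (auto simp: C_def)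
  have disjT: "disjoint \<T>"
    unfolding \<T>_def
  proof (rule disjointI)
    fix S T assume ST: "S \<in> (\<Union>i<t. B i)" "T \<in> (\<Union>i<t. B i)" "S \<noteq> T"
    then obtain i j where ij: "S \<in> B i" "T \<in> B j" by blast
    show "S \<inter> T = {}"
      using across[OF ij] disjointD[OF B(3), of S i T] ij ST(3) by (cases "i = j") auto
  qed
  have cardT: "card \<T> = (\<Sum>i<t. card (C i) div k)"
    unfolding \<T>_def B(1)[symmetric]
  proof (rule card_UN_disjoint)
    show "\<forall>i\<in>{..<t}. \<forall>j\<in>{..<t}. i \<noteq> j \<longrightarrow> B i \<inter> B j = {}"
    proof (intro ballI impI)
      fix i j :: nat assume "i \<noteq> j"
      then have "S \<notin> B j" if "S \<in> B i" for S using across[of S i S j] ne[OF that] that by auto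
      then show "B i \<inter> B j = {}" by blast
    qed
  qed (use B(2) in auto)
  have free: "copy_free_family V H E \<T>"
    unfolding copy_free_family_def
  proof
    fix X assume X: "X \<in> pairs \<T>"
    then obtain S T where ST: "X = {S, T}" "S \<noteq> T" by (auto simp: pairs_def card_2_iff)
    then have "S \<in> \<T>" "T \<in> \<T>" using X by (auto simp: pairs_def)
    then obtain i j where ij: "S \<in> B i" "T \<in> B j" by (auto simp: \<T>_def)
    have sub: "S \<subseteq> C i" "T \<subseteq> C j" using B(4) ij by blast+
    show "\<not> has_induced_copy V H (E \<inter> cross X) (\<Union>X)"
    proof (cases "i = j")
      case True
      have "E \<inter> cross X = {}"
        using sub indC[of i] True unfolding ST cross_pair[OF ST(2)] indep_set_def by auto
      then show ?thesis using no_induced_copy_in_empty_graph[OF H] by simp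
    next
      case False
      have ind: "indep_set E S" "indep_set E T"
        using indC[of i] indC[of j] sub unfolding indep_set_def by blast+
      show ?thesis
      proof
        assume "has_induced_copy V H (E \<inter> cross X) (\<Union>X)"
        then have "has_induced_copy V H E (S \<union> T)"
          using has_induced_copy_cross[OF _ ST(2) ind] by (simp add: ST)
        then have "has_induced_copy V H E (C i \<union> C j)"
          by (rule has_induced_copy_mono) (use sub in auto)
        then show False using copy[OF False] by blast
      qed
    qed
  qed
  have lt: "card \<T> < M"
  proof (rule ccontr)
    assume "\<not> card \<T> < M"
    then obtain \<S> where \<S>: "\<S> \<subseteq> \<T>" "card \<S> = M" by (meson leI obtain_subset_with_card_n)
    have "block_family n k M \<S>"
      unfolding block_family_def
    proof (intro conjI)
      show "\<S> \<subseteq> {S. S \<subseteq> {..<n} \<and> card S = k}"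
      proof
        fix S assume "S \<in> \<S>"
        then obtain i where "S \<in> B i" using \<S>(1) by (auto simp: \<T>_def)
        then show "S \<in> {S. S \<subseteq> {..<n} \<and> card S = k}" using B(4) by (force simp: C_def)
      qed
      show "disjoint \<S>" using disjT \<S>(1) by (rule pairwise_subset)
    qed (rule \<S>(2))
    moreover have "copy_free_family V H E \<S>"
      using free pairs_mono[OF \<S>(1)] unfolding copy_free_family_def by blast
    ultimately show False using M by blast
  qed
  then show "M > 0" by simp
  have "{..<n} = (\<Union>i<t. C i)" using c by (auto simp: C_def H_avoiding_def)
  then have "n = card (\<Union>i<t. C i)" by (metis card_lessThan)
  also have "\<dots> = (\<Sum>i<t. card (C i))"
    by (rule card_UN_disjoint) (auto simp: C_def)
  also have "\<dots> \<le> (\<Sum>i<t. (k - 1) + k * (card (C i) div k))"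
  proof (rule sum_mono)
    fix i
    have "card (C i) mod k \<le> k - 1" using k mod_less_divisor[of k "card (C i)"] by linarith
    then show "card (C i) \<le> (k - 1) + k * (card (C i) div k)"
      using mult_div_mod_eq[of k "card (C i)"] by linarith
  qed
  also have "\<dots> = (k - 1) * t + k * card \<T>"
    by (simp add: sum.distrib sum_distrib_left cardT)
  also have "\<dots> \<le> (k - 1) * t + k * (M - 1)"
    using lt by (intro add_left_mono mult_left_mono) auto
  finally show "n \<le> (k - 1) * t + k * (M - 1)" .
qed

section \<open>Probability of a crossing copy\<close>

lemma epr_ge_sum_weights:
  fixes p :: real
  assumes "0 < p" "p < 1" "finite F" "\<T> \<subseteq> Pow F" "\<And>E. E \<in> \<T> \<Longrightarrow> P E"
  shows "(\<Sum>E\<in>\<T>. eweight p F E) \<le> epr p F P"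
proof -
  have "(\<Sum>E\<in>\<T>. eweight p F E) = (\<Sum>E\<in>\<T>. eweight p F E * of_bool (P E))"
    using assms(5) by (intro sum.cong) auto
  also have "\<dots> \<le> epr p F P"
    unfolding epr_def eexp_def using assms
    by (intro sum_mono2) (auto intro!: mult_nonneg_nonneg eweight_nonneg)
  finally show ?thesis .
qed

lemma has_induced_copy_image:
  assumes "inj_on f V" "H \<subseteq> Pow V" "f ` V \<subseteq> S"
  shows "has_induced_copy V H ((`) f ` H) S"
  unfolding has_induced_copy_def
proof (intro exI conjI ballI impI)
  fix u v assume uv: "u \<in> V" "v \<in> V"
  have "f ` {u, v} \<in> (`) f ` H \<longleftrightarrow> {u, v} \<in> H"
    using inj_on_image_mem_iff[OF inj_on_image_Pow[OF assms(1)], of "{u, v}" H] uv assms(2) by simp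
  then show "{u, v} \<in> H \<longleftrightarrow> {f u, f v} \<in> (`) f ` H" by simp
qed (use assms in auto)

lemma card_cross_pair_le:
  assumes "finite S" "finite T"
  shows "finite (cross {S, T})" "S \<noteq> T \<Longrightarrow> card (cross {S, T}) \<le> card S * card T"
proof -
  have "cross {S, T} \<subseteq> Pow (S \<union> T)" by (auto simp: cross_def)
  then show "finite (cross {S, T})" using assms finite_subset by blast
  show "card (cross {S, T}) \<le> card S * card T" if "S \<noteq> T"
    unfolding cross_pair[OF that] using assms card_image_le[of "S \<times> T"] by (simp add: card_cartesian_product)
qed

lemma epr_no_copy_le:
  fixes p :: real
  assumes p: "0 < p" "p < 1" and H: "simple_graph V H" "(A, B) \<in> bip_parts V H"
    and k: "card A \<le> k" "card B \<le> k" "k > 0"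
    and ST: "finite S" "finite T" "card S = k" "card T = k" "S \<inter> T = {}"
  shows "epr p (cross {S, T}) (\<lambda>E. \<not> has_induced_copy V H E (S \<union> T)) \<le> 1 - (p * (1 - p)) ^ (k * k)"
proof -
  have AB: "A \<union> B = V" "A \<inter> B = {}" "indep_set H A" "indep_set H B"
    using H(2) by (auto simp: bip_parts_def)
  have fV: "finite A" "finite B" using H(1) AB(1) by (auto simp: simple_graph_def)
  obtain f where f: "f ` A \<subseteq> S" "inj_on f A" using card_le_inj[OF fV(1) ST(1)] k ST by auto
  obtain g where g: "g ` B \<subseteq> T" "inj_on g B" using card_le_inj[OF fV(2) ST(2)] k ST by auto
  define h where "h v = (if v \<in> A then f v else g v)" for v
  have hA: "h v \<in> S" if "v \<in> A" for v using f(1) that by (auto simp: h_def)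
  have hB: "h v \<in> T" if "v \<in> B" for v using g(1) AB(2) that by (auto simp: h_def)
  have ne: "S \<noteq> T" using ST k by auto
  have "inj_on h A" using f(2) by (simp add: inj_on_def h_def)
  moreover have "inj_on h B" using g(2) AB(2) by (auto simp: inj_on_def h_def)
  moreover have "h ` A \<inter> h ` B = {}"
  proof -
    have "h ` A \<subseteq> S" "h ` B \<subseteq> T" using hA hB by auto
    then show ?thesis using ST(5) by blast
  qed
  moreover have "A - B = A" "B - A = B" using AB(2) by blast+
  ultimately have inj: "inj_on h V" unfolding AB(1)[symmetric] inj_on_Un by simp
  have HV: "H \<subseteq> Pow V" using H(1) by (auto simp: simple_graph_def)
  define T0 where "T0 = (`) h ` H"
  have copy: "has_induced_copy V H T0 (S \<union> T)"
    unfolding T0_def by (rule has_induced_copy_image[OF inj HV]) (use hA hB AB(1) in auto)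
  have sub: "T0 \<subseteq> cross {S, T}"
  proof
    fix e assume "e \<in> T0"
    then obtain u v where uv: "{u, v} \<in> H" "u \<in> V" "v \<in> V" "e = {h u, h v}"
      using H(1) unfolding T0_def simple_graph_def by auto
    then have "u \<in> A \<and> v \<in> B \<or> u \<in> B \<and> v \<in> A" using AB unfolding indep_set_def by blast
    then show "e \<in> cross {S, T}"
      unfolding cross_pair[OF ne] using uv(4) hA hB by (auto simp: insert_commute)
  qed
  have fin: "finite (cross {S, T})" and card: "card (cross {S, T}) \<le> k * k"
    using card_cross_pair_le[OF ST(1,2)] ne ST by auto
  have T0c: "card T0 \<le> k * k" using card_mono[OF fin sub] card by simp
  have "(p * (1 - p)) ^ (k * k) = p ^ (k * k) * (1 - p) ^ (k * k)" by (rule power_mult_distrib)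
  also have "\<dots> \<le> p ^ card T0 * (1 - p) ^ (card (cross {S, T}) - card T0)"
    using p T0c card by (intro mult_mono power_decreasing) auto
  also have "\<dots> = (\<Sum>E\<in>{T0}. eweight p (cross {S, T}) E)" by (simp add: eweight_def)
  also have "\<dots> \<le> epr p (cross {S, T}) (\<lambda>E. has_induced_copy V H E (S \<union> T))"
    using sub copy by (intro epr_ge_sum_weights[OF p fin]) auto
  finally show ?thesis by (simp add: epr_not[OF fin])
qed

lemma simple_graph_2K2: "simple_graph V2K2 E2K2"
proof -
  have "\<exists>u v. u \<in> V2K2 \<and> v \<in> V2K2 \<and> u \<noteq> v \<and> e = {u, v}" if e: "e \<in> E2K2" for e
  proof -
    consider "e = {0, 1}" | "e = {2, 3}" using e by (auto simp: E2K2_def)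
    then show ?thesis
    proof cases
      case 1
      then show ?thesis by (intro exI[of _ 0] exI[of _ 1]) (simp add: V2K2_def)
    next
      case 2
      then show ?thesis by (intro exI[of _ 2] exI[of _ 3]) (simp add: V2K2_def)
    qed
  qed
  then show ?thesis by (auto simp: simple_graph_def V2K2_def)
qed

lemma bip_parts_2K2:
  assumes "(A, B) \<in> bip_parts V2K2 E2K2"
  shows "2 \<le> card A \<and> 2 \<le> card B"
proof -
  have AB: "A \<union> B = {0, 1, 2, 3}" "A \<inter> B = {}" and ind: "indep_set E2K2 A" "indep_set E2K2 B"
    using assms by (auto simp: bip_parts_def V2K2_def)
  have fin: "finite A" "finite B" using AB(1) by (metis finite_Un finite.emptyI finite.insertI)+
  have no: "\<not> (0 \<in> W \<and> 1 \<in> W)" "\<not> (2 \<in> W \<and> 3 \<in> W)" if "indep_set E2K2 W" for W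
    using that unfolding indep_set_def E2K2_def by blast+
  have two: "2 \<le> card W" if W: "finite W" "0 \<in> W \<or> 1 \<in> W" "2 \<in> W \<or> 3 \<in> W" for W :: "nat set"
  proof -
    obtain a b where ab: "a \<in> {0, 1}" "b \<in> {2, 3}" "{a, b} \<subseteq> W" using W by blast
    then have "card {a, b} = 2" by auto
    then show ?thesis using card_mono[OF W(1) ab(3)] by simp
  qed
  have "0 \<in> A \<or> 1 \<in> A" "2 \<in> A \<or> 3 \<in> A" "0 \<in> B \<or> 1 \<in> B" "2 \<in> B \<or> 3 \<in> B"
    using no[OF ind(1)] no[OF ind(2)] AB(1) by blast+
  then show ?thesis using two fin by blast
qed

lemma epr_no_2K2_le:
  fixes p :: real
  assumes p: "0 < p" "p < 1"
    and ST: "finite S" "finite T" "card S = 2" "card T = 2" "S \<inter> T = {}"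
  shows "epr p (cross {S, T}) (\<lambda>E. \<not> has_induced_copy V2K2 E2K2 E (S \<union> T))
           \<le> 1 - 2 * p\<^sup>2 * (1 - p)\<^sup>2"
proof -
  obtain a b where S: "S = {a, b}" "a \<noteq> b" using ST(3) by (auto simp: card_2_iff)
  obtain x y where T: "T = {x, y}" "x \<noteq> y" using ST(4) by (auto simp: card_2_iff)
  have d: "a \<noteq> x" "a \<noteq> y" "b \<noteq> x" "b \<noteq> y" using ST(5) S T by auto
  have ne: "S \<noteq> T" using ST by auto
  have F: "cross {S, T} = {{a, x}, {a, y}, {b, x}, {b, y}}"
    using cross_pair[OF ne] by (auto simp: S T)
  have cF: "card (cross {S, T}) = 4"
    unfolding F using S(2) T(2) d by (simp add: doubleton_eq_iff)
  have copy: "has_induced_copy V2K2 E2K2 {{u, v}, {w, z}} (S \<union> T)"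
    if "distinct [u, v, w, z]" "{u, v, w, z} \<subseteq> S \<union> T" for u v w z
  proof -
    define f where "f = (\<lambda>i::nat. if i = 0 then u else if i = 1 then v else if i = 2 then w else z)"
    have "inj_on f V2K2" using that(1) by (auto simp: inj_on_def f_def V2K2_def)
    moreover have "E2K2 \<subseteq> Pow V2K2" by (auto simp: E2K2_def V2K2_def)
    moreover have "f ` V2K2 \<subseteq> S \<union> T" using that(2) by (auto simp: f_def V2K2_def)
    ultimately have "has_induced_copy V2K2 E2K2 ((`) f ` E2K2) (S \<union> T)"
      by (rule has_induced_copy_image)
    moreover have "(`) f ` E2K2 = {{u, v}, {w, z}}" by (auto simp: E2K2_def f_def)
    ultimately show ?thesis by simp
  qed
  define T1 where "T1 = {{a, x}, {b, y}}"
  define T2 where "T2 = {{a, y}, {b, x}}"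
  have c: "card T1 = 2" "card T2 = 2" and T12: "T1 \<noteq> T2"
    using S(2) T(2) d by (auto simp: T1_def T2_def doubleton_eq_iff)
  have fin: "finite (cross {S, T})" by (simp add: F)
  have "2 * p\<^sup>2 * (1 - p)\<^sup>2 = (\<Sum>E\<in>{T1, T2}. eweight p (cross {S, T}) E)"
    using c T12 by (simp add: eweight_def cF)
  also have "\<dots> \<le> epr p (cross {S, T}) (\<lambda>E. has_induced_copy V2K2 E2K2 E (S \<union> T))"
  proof (rule epr_ge_sum_weights[OF p fin])
    show "{T1, T2} \<subseteq> Pow (cross {S, T})" unfolding F T1_def T2_def by auto
    show "has_induced_copy V2K2 E2K2 E (S \<union> T)" if "E \<in> {T1, T2}" for E
      using that copy[of a x b y] copy[of a y b x] S T d by (auto simp: T1_def T2_def)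
  qed
  finally show ?thesis by (simp add: epr_not[OF fin])
qed

lemma power_self_le_exp_fact: "real M ^ M \<le> exp (real M) * fact M"
proof -
  have "(\<Sum>n\<in>{M}. inverse (fact n) *\<^sub>R real M ^ n) \<le> (\<Sum>n. inverse (fact n) *\<^sub>R real M ^ n)"
    by (rule sum_le_suminf[OF summable_exp_generic]) auto
  then have "inverse (fact M) * real M ^ M \<le> exp (real M)" by (simp add: exp_def)
  then show ?thesis by (simp add: field_simps)
qed

lemma binomial_le_exp:
  assumes "M > 0" "N > 0"
  shows "real (N choose M) \<le> exp (real M * (ln (real N) - ln (real M) + 1))"
proof -
  have "real ((N choose M) * fact M) \<le> real (N ^ M)"
    using binomial_fact_pow[of N M] by (simp only: of_nat_le_iff)
  then have *: "real (N choose M) * fact M \<le> real N ^ M" by simp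
  have "real (N choose M) * real M ^ M \<le> real (N choose M) * (exp (real M) * fact M)"
    by (intro mult_left_mono power_self_le_exp_fact) simp
  also have "\<dots> = exp (real M) * (real (N choose M) * fact M)" by simp
  also have "\<dots> \<le> exp (real M) * real N ^ M" using * by (intro mult_left_mono) auto
  finally have "real (N choose M) * real M ^ M \<le> exp (real M) * real N ^ M" .
  moreover have "real N ^ M = exp (real M * ln (real N))" "real M ^ M = exp (real M * ln (real M))"
    using assms by (simp_all add: exp_of_nat_mult)
  ultimately have "real (N choose M) \<le> exp (real M) * exp (real M * ln (real N)) / exp (real M * ln (real M))"
    by (simp add: field_simps)
  also have "\<dots> = exp (real M * (ln (real N) - ln (real M) + 1))"
    by (simp add: exp_diff exp_add algebra_simps)
  finally show ?thesis .
qed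

definition block_bound :: "real \<Rightarrow> nat \<Rightarrow> nat \<Rightarrow> nat" where
  "block_bound Q k n = nat \<lceil>2 * real k * log (1 / Q) (real n) - log (1 / Q) (ln (real n))\<rceil>"

lemma real_choose_two: "real (M choose 2) = real M * (real M - 1) / 2"
proof -
  have "2 * (M choose 2) = M * (M - 1)" 
  proof -
    have "even (M * (M - 1))" by (cases M) auto
    then show ?thesis by (simp add: choose_two)
  qed
  then have "2 * real (M choose 2) = real (M * (M - 1))" by (metis of_nat_mult of_nat_numeral)
  then show ?thesis by (cases M) (simp_all add: field_simps)
qed

lemma block_bound_tendsto_0:
  fixes Q :: real
  assumes Q: "0 < Q" "Q < 1" and k: "k > 0"
  shows "(\<lambda>n. real ((n choose k) choose block_bound Q k n) * Q ^ (block_bound Q k n choose 2)) \<longlonglongrightarrow> 0"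
proof (rule tendsto_sandwich[OF _ _ tendsto_const])
  define a where "a = ln (1 / Q)"
  have a: "a > 0" using Q by (simp add: a_def)
  have lnQ: "ln Q = - a" using Q by (simp add: a_def ln_div)
  show "\<forall>\<^sub>F n in sequentially. 0 \<le> real ((n choose k) choose block_bound Q k n) * Q ^ (block_bound Q k n choose 2)"
    using Q by simp
  define c where "c = real k / a"
  have c: "c > 0" using k a by (simp add: c_def)
  show "(\<lambda>n. exp (- (c * ln (real n)))) \<longlonglongrightarrow> 0"
    using c by real_asymp
  define K where "K = a + 4 - 2 * ln c"
  have ev1: "\<forall>\<^sub>F n in sequentially. K \<le> ln (ln (real n))" by real_asymp
  have ev2: "\<forall>\<^sub>F n in sequentially. ln (ln (real n)) \<le> ln (real n)" by real_asymp
  have ev3: "\<forall>\<^sub>F n in sequentially. 1 \<le> ln (real n)" by real_asymp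
  show "\<forall>\<^sub>F n in sequentially.
      real ((n choose k) choose block_bound Q k n) * Q ^ (block_bound Q k n choose 2) \<le> exp (- (c * ln (real n)))"
    using ev1 ev2 ev3 eventually_ge_at_top[of k] eventually_gt_at_top[of 0]
  proof eventually_elim
    case (elim n)
    define L where "L = ln (real n)"
    define M where "M = block_bound Q k n"
    have Mge: "real M \<ge> (2 * real k * L - ln L) / a"
      unfolding M_def block_bound_def log_def a_def[symmetric] L_def
      by (simp add: diff_divide_distrib) linarith
    have "1 * L \<le> real k * L" using elim(3) k by (intro mult_right_mono) (auto simp: L_def)
    then have "ln L \<le> real k * L" using elim(2) by (simp add: L_def)
    then have "c * L \<le> (2 * real k * L - ln L) / a"
      unfolding c_def using a by (simp add: divide_right_mono field_simps)
    then have McL: "c * L \<le> real M" using Mge by linarith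
    have cL: "c * L > 0" using c elim(3) by (simp add: L_def)
    then have M0: "M > 0" using McL by linarith
    have lnM: "ln c + ln L \<le> ln (real M)"
    proof -
      have "ln (c * L) \<le> ln (real M)" using McL cL M0 by (subst ln_le_cancel_iff) auto
      moreover have "ln (c * L) = ln c + ln L" using c elim(3) by (intro ln_mult_pos) (auto simp: L_def)
      ultimately show ?thesis by simp
    qed
    define N where "N = n choose k"
    have N0: "N > 0" using elim(4) by (simp add: N_def)
    have "N \<le> n ^ k" using elim(4) unfolding N_def by (rule binomial_le_pow)
    then have "real N \<le> real n ^ k" by (metis of_nat_le_iff of_nat_power)
    then have "ln (real N) \<le> ln (real n ^ k)" using N0 elim(5) by (subst ln_le_cancel_iff) auto
    also have "\<dots> = real k * L" using elim(5) by (simp add: ln_realpow L_def)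
    finally have lnN: "ln (real N) \<le> real k * L" .
    have Qp: "Q ^ (M choose 2) = exp (real M * (- (a * (real M - 1) / 2)))"
    proof -
      have "Q ^ (M choose 2) = exp (ln Q) ^ (M choose 2)" using Q by simp
      also have "\<dots> = exp (real (M choose 2) * ln Q)" by (simp add: exp_of_nat_mult)
      finally show ?thesis by (simp add: real_choose_two lnQ)
    qed
    have aM: "2 * real k * L - ln L \<le> a * real M" using Mge a by (simp add: field_simps)
    have "real (N choose M) * Q ^ (M choose 2) \<le>
        exp (real M * (ln (real N) - ln (real M) + 1)) * exp (real M * (- (a * (real M - 1) / 2)))"
      unfolding Qp by (intro mult_right_mono binomial_le_exp M0 N0) auto
    also have "\<dots> = exp (real M * (ln (real N) - ln (real M) + 1 - a * (real M - 1) / 2))"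
      by (simp add: exp_add[symmetric] algebra_simps)
    also have "\<dots> \<le> exp (real M * (- 1))"
    proof -
      have "ln (real N) - ln (real M) + 1 - a * (real M - 1) / 2 \<le> - 1"
        using lnN lnM aM elim(1) by (simp add: K_def L_def field_simps)
      then show ?thesis by (intro iffD2[OF exp_le_cancel_iff] mult_left_mono) auto
    qed
    also have "\<dots> \<le> exp (- (c * L))" using McL by simp
    finally show ?case by (simp add: M_def N_def L_def)
  qed
qed

lemma gnp_copy_free_family_tendsto_0:
  fixes p Q :: real
  assumes p: "0 < p" "p < 1" and k: "k > 0" and Q01: "0 < Q" "Q < 1"
    and Q: "\<And>S T. finite S \<Longrightarrow> finite T \<Longrightarrow> card S = k \<Longrightarrow> card T = k \<Longrightarrow> S \<inter> T = {} \<Longrightarrow>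
              epr p (cross {S, T}) (\<lambda>E. \<not> has_induced_copy V H E (S \<union> T)) \<le> Q"
  shows "(\<lambda>n. gnp_prob n p (\<lambda>E. \<exists>\<S>. block_family n k (block_bound Q k n) \<S> \<and>
            copy_free_family V H E \<S>)) \<longlonglongrightarrow> 0"
proof (rule tendsto_sandwich[OF _ _ tendsto_const block_bound_tendsto_0[OF Q01 k]])
  show "\<forall>\<^sub>F n in sequentially. gnp_prob n p (\<lambda>E. \<exists>\<S>. block_family n k (block_bound Q k n) \<S> \<and>
            copy_free_family V H E \<S>)
        \<le> real ((n choose k) choose block_bound Q k n) * Q ^ (block_bound Q k n choose 2)"
    unfolding gnp_prob_eq_epr by (intro always_eventually allI epr_ex_copy_free_family_le[OF p k Q])
qed (simp add: gnp_prob_eq_epr epr_nonneg[OF p])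

lemma chiH_lower_bound:
  fixes Q :: real
  assumes H: "simple_graph V H" "H \<noteq> {}" and E: "E \<subseteq> all_edges n"
    and parts: "\<And>A B. (A, B) \<in> bip_parts V H \<Longrightarrow> 2 \<le> card A \<and> 2 \<le> card B"
    and k: "k \<ge> 2"
    and free: "\<nexists>\<S>. block_family n k (block_bound Q k n) \<S> \<and> copy_free_family V H E \<S>"
  shows "real n \<le> (real k - 1) * real (chiH V H n E) +
           real k * (2 * real k * log (1 / Q) (real n) - log (1 / Q) (ln (real n)))"
proof -
  obtain c where c: "H_avoiding V H n E c (chiH V H n E)"
    using chiH_attained[OF H(1) E parts] by blast
  define M where "M = block_bound Q k n"
  have M: "M > 0" "n \<le> (k - 1) * chiH V H n E + k * (M - 1)"
    using H_avoiding_card_le[OF H E c _ free] k by (auto simp: M_def)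
  have "real n \<le> real ((k - 1) * chiH V H n E + k * (M - 1))" using M(2) by (simp only: of_nat_le_iff)
  also have "\<dots> = (real k - 1) * real (chiH V H n E) + real k * (real M - 1)"
    using k M(1) by (simp add: of_nat_diff)
  also have "real M - 1 \<le> 2 * real k * log (1 / Q) (real n) - log (1 / Q) (ln (real n))"
    using M(1) unfolding M_def block_bound_def by linarith
  finally show ?thesis using k by (simp add: mult_left_mono)
qed

section \<open>Independent \<open>r\<close>-sets in large vertex sets\<close>

text \<open>On the grid \<open>{..<r} \<times> {..<r * t}\<close> the \<open>t\<^sup>2\<close> lines \<open>i \<mapsto> (i, a + i * b)\<close> pairwise meet in
  at most one point, so their pair sets are disjoint and being independent is an independent event.\<close>

lemma epr_no_indep_subset_le:
  fixes p :: real
  assumes p: "0 < p" "p < 1" and W: "W \<subseteq> {..<n}" "card W = r * (r * t)" and r: "r > 0"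
  shows "epr p (all_edges n) (\<lambda>E. \<not> (\<exists>T\<subseteq>W. card T = r \<and> indep_set E T))
           \<le> (1 - (1 - p) ^ (r choose 2)) ^ (t * t)"
proof -
  have finW: "finite W" using W(1) finite_subset by blast
  have "card ({..<r} \<times> {..<r * t}) = card W" by (simp add: W(2))
  then obtain g where g: "bij_betw g ({..<r} \<times> {..<r * t}) W"
    using finite_same_card_bij[of "{..<r} \<times> {..<r * t}" W] finW by auto
  have ginj: "g x = g y \<longleftrightarrow> x = y" if "x \<in> {..<r} \<times> {..<r * t}" "y \<in> {..<r} \<times> {..<r * t}" for x y
    using inj_on_eq_iff[OF bij_betw_imp_inj_on[OF g] that] .
  have grid: "(i, a + i * b) \<in> {..<r} \<times> {..<r * t}" if "i < r" "a < t" "b < t" for i a b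
  proof -
    have "i * b \<le> (r - 1) * b" using that by (intro mult_right_mono) auto
    also have "\<dots> \<le> (r - 1) * t" using that by (intro mult_left_mono) auto
    finally have "a + i * b < t + (r - 1) * t" using that by simp
    also have "\<dots> = r * t" using r by (cases r) auto
    finally show ?thesis using that by simp
  qed
  define B where "B x = (\<lambda>i. g (i, fst x + i * snd x)) ` {..<r}" for x
  define I where "I = {..<t} \<times> {..<t}"
  have BW: "B x \<subseteq> W" if "x \<in> I" for x
    using grid bij_betwE[OF g] that by (auto simp: B_def I_def)
  have finB: "finite (B x)" for x by (simp add: B_def)
  have cB: "card (B x) = r" if "x \<in> I" for x
  proof -
    have "inj_on (\<lambda>i. g (i, fst x + i * snd x)) {..<r}"
    proof (rule inj_onI)
      fix i j assume ij: "i \<in> {..<r}" "j \<in> {..<r}"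
        "g (i, fst x + i * snd x) = g (j, fst x + j * snd x)"
      then have "(i, fst x + i * snd x) = (j, fst x + j * snd x)"
        using ginj[OF grid grid, of i "fst x" "snd x" j "fst x" "snd x"] that by (auto simp: I_def)
      then show "i = j" by simp
    qed
    then show ?thesis by (simp add: B_def card_image)
  qed
  have line: "\<exists>i<r. v = g (i, fst x + i * snd x) \<and> v = g (i, fst y + i * snd y) \<and>
      fst x + i * snd x = fst y + i * snd y"
    if v: "v \<in> B x" "v \<in> B y" and xy: "x \<in> I" "y \<in> I" for v x y
  proof -
    obtain i where i: "i < r" "v = g (i, fst x + i * snd x)" using v(1) by (auto simp: B_def)
    obtain j where j: "j < r" "v = g (j, fst y + j * snd y)" using v(2) by (auto simp: B_def)
    have "(i, fst x + i * snd x) = (j, fst y + j * snd y)"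
      using ginj[OF grid grid, of i "fst x" "snd x" j "fst y" "snd y"] i j xy by (auto simp: I_def)
    then show ?thesis using i j by auto
  qed
  have disj: "pairs (B x) \<inter> pairs (B y) = {}" if xy: "x \<in> I" "y \<in> I" "x \<noteq> y" for x y
  proof (rule ccontr)
    assume "pairs (B x) \<inter> pairs (B y) \<noteq> {}"
    then obtain u v where uv: "u \<noteq> v" "u \<in> B x" "v \<in> B x" "u \<in> B y" "v \<in> B y"
      by (auto simp: pairs_def card_2_iff)
    obtain i where i: "u = g (i, fst x + i * snd x)" "fst x + i * snd x = fst y + i * snd y"
      using line[OF uv(2,4) xy(1,2)] by blast
    obtain j where j: "v = g (j, fst x + j * snd x)" "fst x + j * snd x = fst y + j * snd y"
      using line[OF uv(3,5) xy(1,2)] by blast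
    have "i \<noteq> j" using uv(1) i(1) j(1) by auto
    have "int (fst x) + int i * int (snd x) = int (fst y) + int i * int (snd y)"
      "int (fst x) + int j * int (snd x) = int (fst y) + int j * int (snd y)"
      using i(2) j(2) by (metis of_nat_add of_nat_mult)+
    then have "(int i - int j) * (int (snd x) - int (snd y)) = 0" by (simp add: algebra_simps)
    then have s: "snd x = snd y" using \<open>i \<noteq> j\<close> by simp
    then have "fst x = fst y" using i(2) by simp
    then show False using s xy(3) by (simp add: prod_eq_iff)
  qed
  have "epr p (all_edges n) (\<lambda>E. \<not> (\<exists>T\<subseteq>W. card T = r \<and> indep_set E T)) \<le>
      epr p (all_edges n) (\<lambda>E. \<forall>x\<in>I. E \<inter> pairs (B x) \<noteq> {})"
  proof (rule epr_mono[OF p], intro ballI notI)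
    fix E x
    assume E: "E \<subseteq> all_edges n" "\<not> (\<exists>T\<subseteq>W. card T = r \<and> indep_set E T)"
      and x: "x \<in> I" "E \<inter> pairs (B x) = {}"
    have "indep_set E (B x)" using x(2) by (simp add: indep_set_iff_pairs[OF E(1)])
    then show False using E(2) BW[OF x(1)] cB[OF x(1)] by blast
  qed
  also have "\<dots> = (\<Prod>x\<in>I. epr p (pairs (B x)) (\<lambda>E. E \<noteq> {}))"
  proof (rule epr_Ball_disjoint)
    show "finite I" by (simp add: I_def)
    show "finite (all_edges n)" by (rule finite_all_edges)
    show "pairs (B x) \<subseteq> all_edges n" if "x \<in> I" for x
      unfolding all_edges_eq_pairs by (rule pairs_mono) (use BW[OF that] W(1) in blast)
    show "pairs (B x) \<inter> pairs (B y) = {}" if "x \<in> I" "y \<in> I" "x \<noteq> y" for x y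
      using disj[OF that] .
  qed
  also have "\<dots> = (\<Prod>x\<in>I. 1 - (1 - p) ^ (r choose 2))"
  proof (rule prod.cong[OF refl])
    fix x assume x: "x \<in> I"
    show "epr p (pairs (B x)) (\<lambda>E. E \<noteq> {}) = 1 - (1 - p) ^ (r choose 2)"
      using epr_not[OF finite_pairs[OF finB], of p x "\<lambda>E. E = {}"] epr_empty[OF finite_pairs[OF finB], of p x]
      by (simp add: card_pairs[OF finB] cB[OF x])
  qed
  also have "\<dots> = (1 - (1 - p) ^ (r choose 2)) ^ (t * t)" by (simp add: I_def card_cartesian_product)
  finally show ?thesis .
qed

lemma gnp_no_indep_subset_tendsto_0:
  fixes p :: real
  assumes p: "0 < p" "p < 1" and r: "r \<ge> 2"
  shows "(\<lambda>n. gnp_prob n p (\<lambda>E. \<exists>W\<subseteq>{..<n}. card W = r * (r * nat \<lceil>real n / ln (real n)\<rceil>) \<and>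
            \<not> (\<exists>T\<subseteq>W. card T = r \<and> indep_set E T))) \<longlonglongrightarrow> 0"
proof -
  define \<rho> where "\<rho> = 1 - (1 - p) ^ (r choose 2)"
  have "(1 - p) ^ (r choose 2) < 1" using p r by (intro power_Suc_less_one[THEN less_le_trans] power_less_one_iff[THEN iffD2]) auto
  moreover have "0 < (1 - p) ^ (r choose 2)" using p by simp
  ultimately have \<rho>: "0 < \<rho>" "\<rho> < 1" by (simp_all add: \<rho>_def)
  define b where "b = - ln \<rho>"
  have b: "b > 0" using \<rho> by (simp add: b_def)
  define t where "t n = nat \<lceil>real n / ln (real n)\<rceil>" for n :: nat
  have le: "gnp_prob n p (\<lambda>E. \<exists>W\<subseteq>{..<n}. card W = r * (r * t n) \<and>
      \<not> (\<exists>T\<subseteq>W. card T = r \<and> indep_set E T)) \<le> 2 ^ n * \<rho> ^ (t n * t n)" for n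
  proof -
    define \<W> where "\<W> = {W. W \<subseteq> {..<n} \<and> card W = r * (r * t n)}"
    have sub: "\<W> \<subseteq> Pow {..<n}" by (auto simp: \<W>_def)
    then have fin: "finite \<W>" using finite_subset by blast
    have card: "card \<W> \<le> 2 ^ n" using card_mono[OF _ sub] by (simp add: card_Pow)
    have "gnp_prob n p (\<lambda>E. \<exists>W\<subseteq>{..<n}. card W = r * (r * t n) \<and>
        \<not> (\<exists>T\<subseteq>W. card T = r \<and> indep_set E T)) =
      epr p (all_edges n) (\<lambda>E. \<exists>W\<in>\<W>. \<not> (\<exists>T\<subseteq>W. card T = r \<and> indep_set E T))"
      unfolding gnp_prob_eq_epr \<W>_def by (rule epr_cong) blast
    also have "\<dots> \<le> (\<Sum>W\<in>\<W>. epr p (all_edges n) (\<lambda>E. \<not> (\<exists>T\<subseteq>W. card T = r \<and> indep_set E T)))"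
      by (rule epr_Bex_le[OF p fin])
    also have "\<dots> \<le> (\<Sum>W\<in>\<W>. \<rho> ^ (t n * t n))"
      unfolding \<rho>_def
      by (intro sum_mono epr_no_indep_subset_le[OF p]) (use r in \<open>auto simp: \<W>_def\<close>)
    also have "\<dots> = real (card \<W>) * \<rho> ^ (t n * t n)" by simp
    also have "\<dots> \<le> 2 ^ n * \<rho> ^ (t n * t n)"
    proof (intro mult_right_mono)
      have "real (card \<W>) \<le> real (2 ^ n)" using card by (simp only: of_nat_le_iff)
      then show "real (card \<W>) \<le> 2 ^ n" by simp
    qed (use \<rho> in simp)
    finally show ?thesis .
  qed
  have lim: "(\<lambda>n. exp (real n * ln 2 - b * (real n / ln (real n))\<^sup>2)) \<longlonglongrightarrow> 0"
    using b by real_asymp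
  have ev: "\<forall>\<^sub>F n in sequentially. 0 < ln (real n)" by real_asymp
  show ?thesis
    unfolding t_def[symmetric]
  proof (rule tendsto_sandwich[OF _ _ tendsto_const lim])
    show "\<forall>\<^sub>F n in sequentially. gnp_prob n p (\<lambda>E. \<exists>W\<subseteq>{..<n}. card W = r * (r * t n) \<and>
        \<not> (\<exists>T\<subseteq>W. card T = r \<and> indep_set E T)) \<le> exp (real n * ln 2 - b * (real n / ln (real n))\<^sup>2)"
      using ev
    proof eventually_elim
      case (elim n)
      have tn: "real n / ln (real n) \<le> real (t n)" unfolding t_def by linarith
      have "(real n / ln (real n))\<^sup>2 \<le> (real (t n))\<^sup>2"
        using tn elim by (intro power_mono) auto
      then have "b * (real n / ln (real n))\<^sup>2 \<le> b * (real (t n))\<^sup>2"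
        using b by (intro mult_left_mono) auto
      then have "b * (real n / ln (real n))\<^sup>2 \<le> b * real (t n * t n)"
        by (simp only: power2_eq_square[of "real (t n)"] of_nat_mult)
      moreover have "(2::real) ^ n = exp (real n * ln 2)" by (simp add: exp_of_nat_mult)
      moreover have "\<rho> ^ (t n * t n) = exp (- (b * real (t n * t n)))"
      proof -
        have "\<rho> ^ (t n * t n) = exp (ln \<rho>) ^ (t n * t n)" using \<rho> by simp
        also have "\<dots> = exp (real (t n * t n) * ln \<rho>)" by (rule exp_of_nat_mult[symmetric])
        finally show ?thesis by (simp add: b_def)
      qed
      ultimately have "2 ^ n * \<rho> ^ (t n * t n) \<le> exp (real n * ln 2 - b * (real n / ln (real n))\<^sup>2)"
        by (simp add: exp_add[symmetric])
      then show ?case using le[of n] by linarith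
    qed
  qed (simp add: gnp_prob_eq_epr epr_nonneg[OF p])
qed

section \<open>Large independent sets by the second moment method\<close>

lemma binomial_diff_le:
  assumes "l \<le> k" "k \<le> n"
  shows "real ((n - l) choose (k - l)) \<le> (real k / real n) ^ l * real (n choose k)"
  using assms(1)
proof (induction l)
  case 0
  show ?case by simp
next
  case (Suc l)
  have l: "l < k" "l < n" using Suc.prems assms(2) by auto
  have "Suc (k - Suc l) * ((n - l) choose Suc (k - Suc l)) = (n - l) * ((n - l - 1) choose (k - Suc l))"
    by (rule binomial_absorption)
  then have "(k - l) * ((n - l) choose (k - l)) = (n - l) * ((n - Suc l) choose (k - Suc l))"
    using l by (simp add: Suc_diff_Suc)
  then have "real (k - l) * real ((n - l) choose (k - l)) = real (n - l) * real ((n - Suc l) choose (k - Suc l))"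
    by (metis of_nat_mult)
  then have "real ((n - Suc l) choose (k - Suc l)) = real (k - l) / real (n - l) * real ((n - l) choose (k - l))"
    using l by (simp add: field_simps)
  also have "\<dots> \<le> real k / real n * real ((n - l) choose (k - l))"
  proof (intro mult_right_mono)
    have "real l * real k \<le> real l * real n" using assms(2) by (intro mult_left_mono) auto
    then show "real (k - l) / real (n - l) \<le> real k / real n"
      using l by (simp add: divide_simps of_nat_diff algebra_simps)
  qed simp
  also have "\<dots> \<le> real k / real n * ((real k / real n) ^ l * real (n choose k))"
    using Suc by (intro mult_left_mono) auto
  finally show ?case by simp
qed

lemma card_subsets_meeting_le:
  assumes U: "finite U" "card U = n" and S: "S \<subseteq> U" "card S = k" and l: "l \<le> k" "k \<le> n"
  shows "real (card {T. T \<subseteq> U \<and> card T = k \<and> card (S \<inter> T) = l})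
           \<le> real (k choose l) * ((real k / real n) ^ l * real (n choose k))"
proof -
  define \<A> where "\<A> = {A. A \<subseteq> S \<and> card A = l}"
  define \<F> where "\<F> A = {T. T \<subseteq> U \<and> card T = k \<and> A \<subseteq> T}" for A
  have finS: "finite S" using S U finite_subset by blast
  have finA: "finite \<A>" using finS by (simp add: \<A>_def)
  have finF: "finite (\<F> A)" for A using U by (simp add: \<F>_def)
  have cF: "card (\<F> A) \<le> (n - l) choose (k - l)" if "A \<in> \<A>" for A
  proof -
    have A: "A \<subseteq> U" "card A = l" "finite A" using that S finS finite_subset by (auto simp: \<A>_def)
    have "\<F> A \<subseteq> (\<union>) A ` {R. R \<subseteq> U - A \<and> card R = k - l}"
    proof
      fix T assume T: "T \<in> \<F> A"
      then have "card (T - A) = k - l" using A by (auto simp: \<F>_def card_Diff_subset)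
      moreover have "T = A \<union> (T - A)" "T - A \<subseteq> U - A" using T by (auto simp: \<F>_def)
      ultimately show "T \<in> (\<union>) A ` {R. R \<subseteq> U - A \<and> card R = k - l}" by blast
    qed
    then have "card (\<F> A) \<le> card {R. R \<subseteq> U - A \<and> card R = k - l}"
      using U by (intro surj_card_le) auto
    also have "\<dots> = card (U - A) choose (k - l)" using U by (intro n_subsets) auto
    also have "card (U - A) = n - l" using A U by (simp add: card_Diff_subset)
    finally show ?thesis .
  qed
  have "{T. T \<subseteq> U \<and> card T = k \<and> card (S \<inter> T) = l} \<subseteq> (\<Union>A\<in>\<A>. \<F> A)"
    by (auto simp: \<A>_def \<F>_def intro!: exI[of _ "S \<inter> _"])
  then have "card {T. T \<subseteq> U \<and> card T = k \<and> card (S \<inter> T) = l} \<le> card (\<Union>A\<in>\<A>. \<F> A)"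
    using finA finF by (intro card_mono) auto
  also have "\<dots> \<le> (\<Sum>A\<in>\<A>. card (\<F> A))" by (rule card_UN_le[OF finA])
  also have "\<dots> \<le> (\<Sum>A\<in>\<A>. (n - l) choose (k - l))" by (intro sum_mono cF)
  also have "\<dots> = (k choose l) * ((n - l) choose (k - l))"
    using n_subsets[OF finS, of l] S(2) by (simp add: \<A>_def)
  finally have "real (card {T. T \<subseteq> U \<and> card T = k \<and> card (S \<inter> T) = l})
      \<le> real ((k choose l) * ((n - l) choose (k - l)))"
    by (simp only: of_nat_le_iff)
  also have "\<dots> = real (k choose l) * real ((n - l) choose (k - l))" by simp
  also have "\<dots> \<le> real (k choose l) * ((real k / real n) ^ l * real (n choose k))"
    by (intro mult_left_mono binomial_diff_le l) auto
  finally show ?thesis .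
qed

lemma card_pairs_Un:
  assumes "finite S" "finite T" "card S = k" "card T = k"
  shows "card (pairs S \<union> pairs T) + (card (S \<inter> T) choose 2) = 2 * (k choose 2)"
proof -
  have "pairs S \<inter> pairs T = pairs (S \<inter> T)" by (auto simp: pairs_def)
  then have "card (pairs S) + card (pairs T) = card (pairs S \<union> pairs T) + card (pairs (S \<inter> T))"
    using card_Un_Int[OF finite_pairs[OF assms(1)] finite_pairs[OF assms(2)]] by simp
  then show ?thesis using assms by (simp add: card_pairs)
qed

lemma sum_overlap_le:
  fixes d :: real
  assumes U: "finite U" "card U = n" and S: "S \<subseteq> U" "card S = k" and k: "k \<le> n" and d: "d > 1"
  shows "(\<Sum>T\<in>{T. T \<subseteq> U \<and> card T = k}. d ^ (card (S \<inter> T) choose 2))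
    \<le> real (n choose k) * (1 + (\<Sum>l=2..k. (real k * real k / real n * d powr ((real k - 1) / 2)) ^ l))"
proof -
  define \<K> where "\<K> = {T. T \<subseteq> U \<and> card T = k}"
  have finK: "finite \<K>" using U by (simp add: \<K>_def)
  have cK: "card \<K> = n choose k" using n_subsets[OF U(1), of k] U(2) by (simp add: \<K>_def)
  have finS: "finite S" using S U finite_subset by blast
  define N where "N = real (n choose k)"
  define \<delta> where "\<delta> = d powr ((real k - 1) / 2)"
  have pw: "d ^ (l choose 2) \<le> \<delta> ^ l" if "l \<le> k" for l
  proof -
    have "d ^ (l choose 2) = d powr real (l choose 2)" using d by (simp add: powr_realpow)
    also have "\<dots> = d powr (real l * ((real l - 1) / 2))" by (simp add: real_choose_two)
    also have "\<dots> \<le> d powr (real l * ((real k - 1) / 2))"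
      using d that by (intro powr_mono mult_left_mono) auto
    also have "\<dots> = \<delta> ^ l" using d by (simp add: \<delta>_def powr_power)
    finally show ?thesis .
  qed
  have "(\<Sum>T\<in>\<K>. d ^ (card (S \<inter> T) choose 2))
      \<le> (\<Sum>T\<in>\<K>. 1 + (\<Sum>l=2..k. of_bool (card (S \<inter> T) = l) * d ^ (l choose 2)))"
  proof (rule sum_mono)
    fix T assume "T \<in> \<K>"
    have le: "card (S \<inter> T) \<le> k" using card_mono[OF finS, of "S \<inter> T"] S by simp
    have nn: "0 \<le> (\<Sum>l=2..k. of_bool (card (S \<inter> T) = l) * d ^ (l choose 2))"
      using d by (intro sum_nonneg) auto
    show "d ^ (card (S \<inter> T) choose 2) \<le> 1 + (\<Sum>l=2..k. of_bool (card (S \<inter> T) = l) * d ^ (l choose 2))"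
    proof (cases "card (S \<inter> T) < 2")
      case True
      then have "d ^ (card (S \<inter> T) choose 2) = 1" by (simp add: binomial_eq_0)
      then show ?thesis using nn by linarith
    next
      case False
      have "of_bool (card (S \<inter> T) = card (S \<inter> T)) * d ^ (card (S \<inter> T) choose 2)
          \<le> (\<Sum>l=2..k. of_bool (card (S \<inter> T) = l) * d ^ (l choose 2))"
        by (rule member_le_sum) (use False le d in auto)
      then show ?thesis by simp
    qed
  qed
  also have "\<dots> = N + (\<Sum>l=2..k. real (card {T. T \<subseteq> U \<and> card T = k \<and> card (S \<inter> T) = l}) * d ^ (l choose 2))"
  proof -
    have cnt: "(\<Sum>T\<in>\<K>. of_bool (card (S \<inter> T) = l) * d ^ (l choose 2)) =
        real (card {T. T \<subseteq> U \<and> card T = k \<and> card (S \<inter> T) = l}) * d ^ (l choose 2)" for l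
    proof -
      have "(\<Sum>T\<in>\<K>. of_bool (card (S \<inter> T) = l) :: real) = real (card (\<K> \<inter> {T. card (S \<inter> T) = l}))"
        using finK by (simp add: sum.If_cases of_bool_def)
      also have "\<K> \<inter> {T. card (S \<inter> T) = l} = {T. T \<subseteq> U \<and> card T = k \<and> card (S \<inter> T) = l}"
        by (auto simp: \<K>_def)
      finally show ?thesis by (simp only: sum_distrib_right[symmetric])
    qed
    have "(\<Sum>T\<in>\<K>. \<Sum>l=2..k. of_bool (card (S \<inter> T) = l) * d ^ (l choose 2)) =
        (\<Sum>l=2..k. \<Sum>T\<in>\<K>. of_bool (card (S \<inter> T) = l) * d ^ (l choose 2))"
      by (rule sum.swap)
    then have "(\<Sum>T\<in>\<K>. 1 + (\<Sum>l=2..k. of_bool (card (S \<inter> T) = l) * d ^ (l choose 2))) =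
        (\<Sum>T\<in>\<K>. 1) + (\<Sum>l=2..k. real (card {T. T \<subseteq> U \<and> card T = k \<and> card (S \<inter> T) = l}) * d ^ (l choose 2))"
      by (simp only: sum.distrib cnt)
    then show ?thesis by (simp add: cK N_def)
  qed
  also have "\<dots> \<le> N + (\<Sum>l=2..k. N * (real k * real k / real n * \<delta>) ^ l)"
  proof (intro add_left_mono sum_mono)
    fix l assume l: "l \<in> {2..k}"
    then have "(k choose l) \<le> k ^ l" by (intro binomial_le_pow) auto
    then have "real (k choose l) \<le> real (k ^ l)" by (simp only: of_nat_le_iff)
    then have kl: "real (k choose l) \<le> real k ^ l" by simp
    have "real (card {T. T \<subseteq> U \<and> card T = k \<and> card (S \<inter> T) = l}) * d ^ (l choose 2)
        \<le> (real (k choose l) * ((real k / real n) ^ l * N)) * \<delta> ^ l"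
      unfolding N_def using l d k
      by (intro mult_mono card_subsets_meeting_le[OF U S] pw) auto
    also have "\<dots> \<le> (real k ^ l * ((real k / real n) ^ l * N)) * \<delta> ^ l"
      using kl d by (intro mult_right_mono) (auto simp: N_def \<delta>_def)
    also have "\<dots> = N * (real k * real k / real n * \<delta>) ^ l"
      by (simp add: power_mult_distrib power_divide)
    finally show "real (card {T. T \<subseteq> U \<and> card T = k \<and> card (S \<inter> T) = l}) * d ^ (l choose 2)
        \<le> N * (real k * real k / real n * \<delta>) ^ l" .
  qed
  also have "\<dots> = N * (1 + (\<Sum>l=2..k. (real k * real k / real n * \<delta>) ^ l))"
    by (simp add: sum_distrib_left distrib_left)
  finally show ?thesis by (simp add: \<K>_def N_def \<delta>_def)
qed

lemma sum_powers_from_2_le: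
  fixes \<beta> :: real
  assumes "0 \<le> \<beta>" "\<beta> \<le> 1 / 2"
  shows "(\<Sum>l=2..k. \<beta> ^ l) \<le> \<beta>"
proof -
  have "(\<Sum>l=2..k. \<beta> ^ l) \<le> 2 * \<beta>\<^sup>2 - 2 * \<beta> ^ (k + 1)" if "k \<ge> 1"
    using that
  proof (induction k rule: nat_induct_at_least)
    case base
    show ?case by (simp add: power2_eq_square)
  next
    case (Suc k)
    have "(\<Sum>l=2..Suc k. \<beta> ^ l) = (\<Sum>l=2..k. \<beta> ^ l) + \<beta> ^ Suc k" using Suc.hyps by simp
    moreover have "\<beta> * \<beta> ^ Suc k \<le> 1 / 2 * \<beta> ^ Suc k" using assms by (intro mult_right_mono) auto
    ultimately show ?case using Suc.IH by simp
  qed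
  moreover have "2 * \<beta>\<^sup>2 \<le> \<beta>"
    using mult_right_mono[OF assms(2,1)] by (simp add: power2_eq_square)
  moreover have "0 \<le> \<beta> ^ (k + 1)" using assms by simp
  ultimately have "(\<Sum>l=2..k. \<beta> ^ l) \<le> \<beta>" if "k \<ge> 1" using that by linarith
  then show ?thesis using assms(1) by (cases "k \<ge> 1") auto
qed

lemma epr_no_indep_set_le:
  fixes p d \<beta> :: real
  assumes p: "0 < p" "p < 1" and k: "k \<le> n" and d: "d = 1 / (1 - p)"
    and \<beta>: "\<beta> = real k * real k / real n * d powr ((real k - 1) / 2)" "\<beta> \<le> 1 / 2"
  shows "epr p (all_edges n) (\<lambda>E. \<not> (\<exists>S\<subseteq>{..<n}. card S = k \<and> indep_set E S)) \<le> \<beta>"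
proof -
  define \<K> where "\<K> = {S. S \<subseteq> {..<n} \<and> card S = k}"
  have finK: "finite \<K>" by (simp add: \<K>_def)
  have cK: "card \<K> = n choose k" using n_subsets[of "{..<n}" k] by (simp add: \<K>_def)
  have finS: "finite S" if "S \<in> \<K>" for S using that finite_subset by (auto simp: \<K>_def)
  define N where "N = real (n choose k)"
  have N: "N > 0" using k by (simp add: N_def)
  define X where "X E = (\<Sum>S\<in>\<K>. of_bool (E \<inter> pairs S = {}) :: real)" for E
  define \<mu> where "\<mu> = (1 - p) ^ (k choose 2)"
  have \<mu>: "\<mu> > 0" using p by (simp add: \<mu>_def)
  have d1: "d > 1" using p by (simp add: d)
  have sub: "pairs S \<subseteq> all_edges n" if "S \<in> \<K>" for S
    unfolding all_edges_eq_pairs using that by (intro pairs_mono) (auto simp: \<K>_def)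
  have empty: "epr p (all_edges n) (\<lambda>E. E \<inter> G = {}) = (1 - p) ^ card G" if "G \<subseteq> all_edges n" for G
    using epr_restrict[OF finite_all_edges that, of p "\<lambda>E. E = {}"]
      epr_empty[OF finite_subset[OF that finite_all_edges]] by simp
  have EX: "eexp p (all_edges n) X = N * \<mu>"
  proof -
    have "eexp p (all_edges n) X = (\<Sum>S\<in>\<K>. epr p (all_edges n) (\<lambda>E. E \<inter> pairs S = {}))"
      unfolding X_def eexp_sum epr_def ..
    also have "\<dots> = (\<Sum>S\<in>\<K>. \<mu>)"
    proof (rule sum.cong[OF refl])
      fix S assume S: "S \<in> \<K>"
      then have "card S = k" by (simp add: \<K>_def)
      then show "epr p (all_edges n) (\<lambda>E. E \<inter> pairs S = {}) = \<mu>"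
        using empty[OF sub[OF S]] card_pairs[OF finS[OF S]] by (simp add: \<mu>_def)
    qed
    finally show ?thesis by (simp add: cK N_def)
  qed
  have EXX: "eexp p (all_edges n) (\<lambda>E. X E * X E) \<le> (N * \<mu>)\<^sup>2 * (1 + \<beta>)"
  proof -
    have "eexp p (all_edges n) (\<lambda>E. X E * X E) =
        eexp p (all_edges n) (\<lambda>E. \<Sum>S\<in>\<K>. \<Sum>T\<in>\<K>. of_bool (E \<inter> (pairs S \<union> pairs T) = {}))"
    proof (rule eexp_cong)
      fix E :: "nat set set"
      have "E \<inter> (pairs S \<union> pairs T) = {} \<longleftrightarrow> E \<inter> pairs S = {} \<and> E \<inter> pairs T = {}" for S T by blast
      then show "X E * X E = (\<Sum>S\<in>\<K>. \<Sum>T\<in>\<K>. of_bool (E \<inter> (pairs S \<union> pairs T) = {}))"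
        unfolding X_def sum_product by (simp add: of_bool_conj)
    qed
    also have "\<dots> = (\<Sum>S\<in>\<K>. \<Sum>T\<in>\<K>. epr p (all_edges n) (\<lambda>E. E \<inter> (pairs S \<union> pairs T) = {}))"
      unfolding eexp_sum epr_def ..
    also have "\<dots> = (\<Sum>S\<in>\<K>. \<Sum>T\<in>\<K>. \<mu>\<^sup>2 * d ^ (card (S \<inter> T) choose 2))"
    proof (intro sum.cong refl)
      fix S T assume ST: "S \<in> \<K>" "T \<in> \<K>"
      have c: "card (pairs S \<union> pairs T) + (card (S \<inter> T) choose 2) = 2 * (k choose 2)"
        using card_pairs_Un[OF finS[OF ST(1)] finS[OF ST(2)]] ST by (simp add: \<K>_def)
      have "(1 - p) ^ card (pairs S \<union> pairs T) * (1 - p) ^ (card (S \<inter> T) choose 2) = \<mu>\<^sup>2"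
        unfolding power_add[symmetric] c \<mu>_def by (simp add: power_mult[symmetric] mult.commute)
      then have "(1 - p) ^ card (pairs S \<union> pairs T) = \<mu>\<^sup>2 * d ^ (card (S \<inter> T) choose 2)"
        using p by (simp add: d power_divide field_simps)
      then show "epr p (all_edges n) (\<lambda>E. E \<inter> (pairs S \<union> pairs T) = {}) =
          \<mu>\<^sup>2 * d ^ (card (S \<inter> T) choose 2)"
        using empty[of "pairs S \<union> pairs T"] sub[OF ST(1)] sub[OF ST(2)] by simp
    qed
    also have "\<dots> = (\<Sum>S\<in>\<K>. \<mu>\<^sup>2 * (\<Sum>T\<in>\<K>. d ^ (card (S \<inter> T) choose 2)))"
      by (simp add: sum_distrib_left)
    also have "\<dots> \<le> (\<Sum>S\<in>\<K>. \<mu>\<^sup>2 * (N * (1 + \<beta>)))"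
    proof (intro sum_mono mult_left_mono)
      fix S assume S: "S \<in> \<K>"
      have b0: "0 \<le> \<beta>" by (simp add: \<beta>(1))
      have "(\<Sum>T\<in>\<K>. d ^ (card (S \<inter> T) choose 2)) \<le> N * (1 + (\<Sum>l=2..k. \<beta> ^ l))"
        unfolding \<K>_def N_def \<beta>(1)
        by (rule sum_overlap_le) (use S k d1 in \<open>auto simp: \<K>_def\<close>)
      also have "\<dots> \<le> N * (1 + \<beta>)"
        using sum_powers_from_2_le[OF b0 \<beta>(2), of k] N by (intro mult_left_mono) auto
      finally show "(\<Sum>T\<in>\<K>. d ^ (card (S \<inter> T) choose 2)) \<le> N * (1 + \<beta>)" .
    qed simp
    also have "\<dots> = (N * \<mu>)\<^sup>2 * (1 + \<beta>)" by (simp add: cK N_def power2_eq_square)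
    finally show ?thesis .
  qed
  have "epr p (all_edges n) (\<lambda>E. \<not> (\<exists>S\<subseteq>{..<n}. card S = k \<and> indep_set E S)) \<le>
      epr p (all_edges n) (\<lambda>E. X E = 0)"
  proof (rule epr_mono[OF p])
    fix E assume E: "E \<subseteq> all_edges n" "\<not> (\<exists>S\<subseteq>{..<n}. card S = k \<and> indep_set E S)"
    then have "E \<inter> pairs S \<noteq> {}" if "S \<in> \<K>" for S
      using that indep_set_iff_pairs[OF E(1), of S] by (auto simp: \<K>_def)
    then show "X E = 0" unfolding X_def by (intro sum.neutral) auto
  qed
  also have "\<dots> \<le> eexp p (all_edges n) (\<lambda>E. X E * X E) / (eexp p (all_edges n) X)\<^sup>2 - 1"
    using N \<mu> by (intro epr_zero_le_second_moment[OF p finite_all_edges]) (simp add: EX)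
  also have "\<dots> \<le> (N * \<mu>)\<^sup>2 * (1 + \<beta>) / (N * \<mu>)\<^sup>2 - 1"
    unfolding EX by (intro diff_right_mono divide_right_mono EXX) simp
  also have "\<dots> = \<beta>" using N \<mu> by simp
  finally show ?thesis .
qed

definition indep_size :: "real \<Rightarrow> nat \<Rightarrow> nat" where
  "indep_size d n = nat \<lfloor>2 * log d (real n) - 6 * log d (ln (real n))\<rfloor>"

lemma gnp_no_indep_set_tendsto_0:
  fixes p d :: real
  assumes p: "0 < p" "p < 1" and d: "d = 1 / (1 - p)"
  shows "(\<lambda>n. gnp_prob n p (\<lambda>E. \<not> (\<exists>S\<subseteq>{..<n}. card S = indep_size d n \<and> indep_set E S))) \<longlonglongrightarrow> 0"
proof -
  define a where "a = ln d"
  have d1: "d > 1" using p by (simp add: d)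
  have a: "a > 0" using d1 by (simp add: a_def)
  define c where "c = 4 / a\<^sup>2"
  have c: "c > 0" using a by (simp add: c_def)
  have lim: "(\<lambda>n. c / ln (real n)) \<longlonglongrightarrow> 0" by real_asymp
  have ev1: "\<forall>\<^sub>F n in sequentially. c / ln (real n) < 1 / 2"
    using order_tendstoD(2)[OF lim, of "1 / 2"] by simp
  have ev2: "\<forall>\<^sub>F n in sequentially. 1 \<le> ln (real n)" by real_asymp
  have ev3: "\<forall>\<^sub>F n in sequentially. 0 \<le> 2 * ln (real n) / a - 6 * ln (ln (real n)) / a" using a by real_asymp
  have ev4: "\<forall>\<^sub>F n in sequentially. 2 * ln (real n) / a \<le> real n" using a by real_asymp
  have "\<forall>\<^sub>F n in sequentially. gnp_prob n p (\<lambda>E. \<not> (\<exists>S\<subseteq>{..<n}. card S = indep_size d n \<and> indep_set E S))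
      \<le> c / ln (real n)"
    using ev1 ev2 ev3 ev4 eventually_gt_at_top[of 0]
  proof eventually_elim
    case (elim n)
    define L where "L = ln (real n)"
    define k where "k = indep_size d n"
    have L: "L \<ge> 1" using elim(2) by (simp add: L_def)
    have lnL: "ln L \<ge> 0" using L by simp
    have k1: "real k \<le> 2 * L / a - 6 * ln L / a"
      using elim(3) unfolding k_def indep_size_def log_def a_def[symmetric] L_def
      by (simp add: of_nat_nat) 
    have "6 * ln L / a \<ge> 0" using lnL a by simp
    then have k2: "real k \<le> 2 * L / a" using k1 by linarith
    then have kn: "k \<le> n" using elim(4) by (simp add: L_def)
    define \<beta> where "\<beta> = real k * real k / real n * d powr ((real k - 1) / 2)"
    have "(real k - 1) / 2 * a \<le> L - 3 * ln L"
    proof -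
      have "real k * a \<le> 2 * L - 6 * ln L" using k1 a by (simp add: field_simps)
      moreover have "(real k - 1) / 2 * a = (real k * a - a) / 2" by (simp add: algebra_simps)
      ultimately show ?thesis using a by simp
    qed
    then have "d powr ((real k - 1) / 2) \<le> exp (L - 3 * ln L)"
      using d1 by (simp add: powr_def a_def)
    also have "\<dots> = real n / L ^ 3"
    proof -
      have "exp (3 * ln L) = L ^ 3" using L exp_of_nat_mult[of 3 "ln L"] by simp
      then show ?thesis using elim(5) by (simp add: exp_diff L_def)
    qed
    finally have pw: "d powr ((real k - 1) / 2) \<le> real n / L ^ 3" .
    have "\<beta> \<le> (2 * L / a) * (2 * L / a) / real n * (real n / L ^ 3)"
      unfolding \<beta>_def using k2 pw L a by (intro mult_mono divide_right_mono) auto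
    also have "\<dots> = c / L"
      using elim(5) L a by (simp add: c_def field_simps power2_eq_square power3_eq_cube)
    finally have \<beta>: "\<beta> \<le> c / L" .
    then have "\<beta> \<le> 1 / 2" using elim(1) unfolding L_def by linarith
    then have "epr p (all_edges n) (\<lambda>E. \<not> (\<exists>S\<subseteq>{..<n}. card S = k \<and> indep_set E S)) \<le> \<beta>"
      by (rule epr_no_indep_set_le[OF p kn d \<beta>_def])
    then show ?case using \<beta> by (simp add: gnp_prob_eq_epr k_def L_def)
  qed
  then show ?thesis
    by (intro tendsto_sandwich[OF _ _ tendsto_const lim]) (simp_all add: gnp_prob_eq_epr epr_nonneg[OF p])
qed

section \<open>High-probability bounds\<close>

lemma gnp_chiH_bounds_tendsto_1:
  fixes p Q :: real
  assumes p: "0 < p" "p < 1" and H: "simple_graph V H" and k: "k \<ge> 2"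
    and parts: "\<And>A B. (A, B) \<in> bip_parts V H \<Longrightarrow> 2 \<le> card A \<and> 2 \<le> card B"
    and Q01: "0 < Q" "Q < 1"
    and Q: "\<And>S T. finite S \<Longrightarrow> finite T \<Longrightarrow> card S = k \<Longrightarrow> card T = k \<Longrightarrow> S \<inter> T = {} \<Longrightarrow>
              epr p (cross {S, T}) (\<lambda>E. \<not> has_induced_copy V H E (S \<union> T)) \<le> Q"
    and B: "(\<lambda>n. gnp_prob n p (B n)) \<longlonglongrightarrow> 0"
    and upper: "\<forall>\<^sub>F n in sequentially. \<forall>E\<subseteq>all_edges n. \<not> B n E \<longrightarrow> real (chiH V H n E) \<le> u n"
    and lower: "\<forall>\<^sub>F n in sequentially. \<forall>x. real n \<le> (real k - 1) * x +
       real k * (2 * real k * log (1 / Q) (real n) - log (1 / Q) (ln (real n))) \<longrightarrow> l n \<le> x"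
  shows "(\<lambda>n. gnp_prob n p (\<lambda>E. l n \<le> real (chiH V H n E) \<and> real (chiH V H n E) \<le> u n)) \<longlonglongrightarrow> 1"
proof (rule epr_tendsto_1I[OF p gnp_copy_free_family_tendsto_0[OF p _ Q01 Q] B])
  have ne: "H \<noteq> {}"
    by (rule has_edge_if_bip_parts_nonempty[OF H]) (use parts in fastforce)
  show "\<forall>\<^sub>F n in sequentially. \<forall>E\<subseteq>all_edges n.
      \<not> (\<exists>\<S>. block_family n k (block_bound Q k n) \<S> \<and> copy_free_family V H E \<S>) \<longrightarrow>
      \<not> B n E \<longrightarrow> l n \<le> real (chiH V H n E) \<and> real (chiH V H n E) \<le> u n"
    using upper lower
  proof eventually_elim
    case (elim n)
    show ?case
    proof (intro allI impI conjI)
      fix E assume E: "E \<subseteq> all_edges n" "\<not> B n E"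
        "\<not> (\<exists>\<S>. block_family n k (block_bound Q k n) \<S> \<and> copy_free_family V H E \<S>)"
      show "real (chiH V H n E) \<le> u n" using elim(1) E by blast
      show "l n \<le> real (chiH V H n E)"
        using elim(2) chiH_lower_bound[OF H ne E(1) parts k E(3)] by blast
    qed
  qed
qed (use k in auto)

lemma eventually_chiH_le_indep_size:
  fixes d :: real
  assumes H: "simple_graph V H" and d: "d > 1"
    and parts: "\<And>A B. (A, B) \<in> bip_parts V H \<Longrightarrow> 2 \<le> card A \<and> 2 \<le> card B"
  shows "\<forall>\<^sub>F n in sequentially. \<forall>E\<subseteq>all_edges n.
    \<not> \<not> (\<exists>S\<subseteq>{..<n}. card S = indep_size d n \<and> indep_set E S) \<longrightarrow>
    real (chiH V H n E) \<le> real n - 2 * log d (real n) + 7 * log d (ln (real n))"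
proof -
  have a: "ln d > 0" using d by simp
  then have "\<forall>\<^sub>F n in sequentially. 2 \<le> ln (ln (real n)) / ln d" by real_asymp
  then show ?thesis
  proof eventually_elim
    case (elim n)
    show ?case
    proof (intro allI impI)
      fix E assume E: "E \<subseteq> all_edges n" "\<not> \<not> (\<exists>S\<subseteq>{..<n}. card S = indep_size d n \<and> indep_set E S)"
      then obtain S where S: "S \<subseteq> {..<n}" "card S = indep_size d n" "indep_set E S" by blast
      have le: "card S \<le> n" using card_mono[OF _ S(1)] by simp
      have "real (chiH V H n E) \<le> real (n - card S + 1)"
        using chiH_le_indep_set[OF H E(1) parts S(1,3)] by (simp only: of_nat_le_iff)
      also have "\<dots> = real n - real (card S) + 1" using le by simp
      finally have chi: "real (chiH V H n E) \<le> real n - real (card S) + 1" .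
      have "real (card S) \<ge> 2 * log d (real n) - 6 * log d (ln (real n)) - 1"
        unfolding S(2) indep_size_def by linarith
      moreover have "2 \<le> log d (ln (real n))" using elim by (simp add: log_def)
      ultimately show "real (chiH V H n E) \<le> real n - 2 * log d (real n) + 7 * log d (ln (real n))"
        using chi by linarith
    qed
  qed
qed

lemma eventually_chiH_le_greedy:
  fixes d :: real
  assumes H: "simple_graph V H" and d: "d > 1" and k1: "kH1 V H \<ge> 3" and r: "r = kH1 V H - 1"
  shows "\<forall>\<^sub>F n in sequentially. \<forall>E\<subseteq>all_edges n.
    \<not> (\<exists>W\<subseteq>{..<n}. card W = r * (r * nat \<lceil>real n / ln (real n)\<rceil>) \<and>
         \<not> (\<exists>T\<subseteq>W. card T = r \<and> indep_set E T)) \<longrightarrow>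
    real (chiH V H n E) \<le> real n / (real (kH1 V H) - 1) + 2 * (real r)\<^sup>2 / ln d * (real n / log d (real n))"
proof -
  have a: "ln d > 0" using d by simp
  have "\<forall>\<^sub>F n in sequentially. 1 \<le> real n / ln (real n)" by real_asymp
  then show ?thesis
  proof eventually_elim
    case (elim n)
    define t where "t = nat \<lceil>real n / ln (real n)\<rceil>"
    have t: "real t \<le> 2 * (real n / ln (real n))" using elim unfolding t_def by linarith
    have r0: "real r > 0" "real (kH1 V H) - 1 = real r" using k1 by (auto simp: r of_nat_diff)
    show ?case
      unfolding t_def[symmetric]
    proof (intro allI impI)
      fix E assume E: "E \<subseteq> all_edges n"
        "\<not> (\<exists>W\<subseteq>{..<n}. card W = r * (r * t) \<and> \<not> (\<exists>T\<subseteq>W. card T = r \<and> indep_set E T))"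
      have "r * chiH V H n E \<le> n + r * (r * (r * t))"
        unfolding r
      proof (rule chiH_le_greedy[OF H E(1)])
        show "\<exists>T\<subseteq>W. card T = kH1 V H - 1 \<and> indep_set E T"
          if "W \<subseteq> {..<n}" "card W = (kH1 V H - 1) * ((kH1 V H - 1) * t)" for W
          using E(2) that unfolding r by blast
      qed (use k1 in simp)
      then have "real (r * chiH V H n E) \<le> real (n + r * (r * (r * t)))" by (simp only: of_nat_le_iff)
      then have "real r * real (chiH V H n E) \<le> real n + real r * ((real r)\<^sup>2 * real t)"
        by (simp add: power2_eq_square mult.assoc)
      then have "real (chiH V H n E) \<le> real n / real r + (real r)\<^sup>2 * real t"
        using r0 by (simp add: field_simps)
      also have "(real r)\<^sup>2 * real t \<le> (real r)\<^sup>2 * (2 * (real n / ln (real n)))"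
        by (intro mult_left_mono t) auto
      also have "\<dots> = 2 * (real r)\<^sup>2 / ln d * (real n / log d (real n))"
        using a by (simp add: log_def)
      finally show "real (chiH V H n E) \<le> real n / (real (kH1 V H) - 1) +
          2 * (real r)\<^sup>2 / ln d * (real n / log d (real n))"
        by (simp add: r0(2))
    qed
  qed
qed

lemma eventually_lower_bound_from_blocks:
  fixes Q :: real
  assumes Q: "0 < Q" "Q < 1" and k: "k \<ge> 2"
  shows "\<forall>\<^sub>F n in sequentially. \<forall>x. real n \<le> (real k - 1) * x +
      real k * (2 * real k * log (1 / Q) (real n) - log (1 / Q) (ln (real n))) \<longrightarrow>
      real n / (real k - 1) - 2 * (real k)\<^sup>2 / ((real k - 1) * ln (1 / Q)) * ln (real n) \<le> x"
proof -
  have a: "ln (1 / Q) > 0" using Q by simp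
  have "\<forall>\<^sub>F n in sequentially. 1 \<le> ln (real n)" by real_asymp
  then show ?thesis
  proof eventually_elim
    case (elim n)
    define a where "a = ln (1 / Q)"
    have a0: "a > 0" using a by (simp add: a_def)
    show ?case
    proof (intro allI impI)
      fix x assume x: "real n \<le> (real k - 1) * x +
        real k * (2 * real k * log (1 / Q) (real n) - log (1 / Q) (ln (real n)))"
      have "log (1 / Q) (ln (real n)) \<ge> 0" using elim a by (simp add: log_def)
      then have "real k * (2 * real k * log (1 / Q) (real n) - log (1 / Q) (ln (real n)))
          \<le> real k * (2 * real k * log (1 / Q) (real n))" by (intro mult_left_mono) auto
      also have "\<dots> = 2 * (real k)\<^sup>2 * ln (real n) / a"
        by (simp add: log_def a_def power2_eq_square)
      finally have "real n - 2 * (real k)\<^sup>2 * ln (real n) / a \<le> (real k - 1) * x" using x by linarith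
      then have "(real n - 2 * (real k)\<^sup>2 * ln (real n) / a) / (real k - 1) \<le> x"
        using k by (simp add: pos_divide_le_eq mult.commute)
      moreover have "(real n - 2 * (real k)\<^sup>2 * ln (real n) / a) / (real k - 1) =
          real n / (real k - 1) - 2 * (real k)\<^sup>2 / ((real k - 1) * a) * ln (real n)"
        by (simp add: diff_divide_distrib mult.commute)
      ultimately show "real n / (real k - 1) - 2 * (real k)\<^sup>2 / ((real k - 1) * ln (1 / Q)) * ln (real n) \<le> x"
        by (simp add: a_def)
    qed
  qed
qed

theorem theorem3:
  fixes VH :: "'b set" and EH :: "'b set set" and p :: real
  assumes "simple_graph VH EH" and "bipartite VH EH"
    and "0 < p" and "p < 1"
  defines "d \<equiv> 1 / (1 - p)"
  shows
   "(kH1 VH EH \<ge> 3 \<and> kH2 VH EH \<ge> 2 \<longrightarrow>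
      (\<exists>C C'. (\<lambda>n. gnp_prob n p (\<lambda>E.
          real n / (real (kH1 VH EH) - 1) - C * ln (real n) \<le> real (chiH VH EH n E) \<and>
          real (chiH VH EH n E) \<le> real n / (real (kH1 VH EH) - 1) + C' * (real n / log d (real n))))
        \<longlonglongrightarrow> 1))
  \<and> (kH1 VH EH = 2 \<and> kH2 VH EH = 2 \<longrightarrow>
      (\<exists>C C'. (\<lambda>n. gnp_prob n p (\<lambda>E.
          real n - C * ln (real n) \<le> real (chiH VH EH n E) \<and>
          real (chiH VH EH n E) \<le> real n - 2 * log d (real n) + C' * log d (ln (real n))))
        \<longlonglongrightarrow> 1))
  \<and> (let Q = 1 - 2 * p\<^sup>2 * (1 - p)\<^sup>2 in
      (\<exists>c C'. c > 0 \<and> (\<lambda>n. gnp_prob n p (\<lambda>E.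
          real n - 8 * log (1 / Q) (real n) + c * log (1 / Q) (ln (real n)) \<le> real (chiH V2K2 E2K2 n E) \<and>
          real (chiH V2K2 E2K2 n E) \<le> real n - 2 * log d (real n) + C' * log d (ln (real n))))
        \<longlonglongrightarrow> 1))"
proof -
  note H = assms(1) and p = assms(3,4)
  have d: "d = 1 / (1 - p)" by (simp add: d_def)
  have d1: "d > 1" using p by (simp add: d)
  define k where "k = kH1 VH EH"
  define q where "q = 1 - (p * (1 - p)) ^ (k * k)"
  obtain A0 B0 where AB0: "(A0, B0) \<in> bip_parts VH EH" "max (card A0) (card B0) = k"
    using kH1_attained[OF assms(1,2)] unfolding k_def by blast
  have parts: "2 \<le> card A \<and> 2 \<le> card B" if "kH2 VH EH \<ge> 2" "(A, B) \<in> bip_parts VH EH" for A B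
    using kH2_le[OF H that(2)] that(1) by simp
  have nocopy: "epr p (cross {S, T}) (\<lambda>E. \<not> has_induced_copy VH EH E (S \<union> T)) \<le> q"
    if "k \<ge> 2" "finite S" "finite T" "card S = k" "card T = k" "S \<inter> T = {}" for S T
    unfolding q_def by (rule epr_no_copy_le[OF p H AB0(1)]) (use that AB0(2) in auto)
  have q01: "0 < q" "q < 1" if "k \<ge> 2"
  proof -
    have "p * (1 - p) < 1 * 1" using p by (intro mult_strict_mono) auto
    then have "(p * (1 - p)) ^ (k * k) < 1" using p that by (subst power_less_one_iff) auto
    moreover have "0 < (p * (1 - p)) ^ (k * k)" using p by simp
    ultimately show "0 < q" "q < 1" by (simp_all add: q_def)
  qed
  have i: "\<exists>C C'. (\<lambda>n. gnp_prob n p (\<lambda>E.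
          real n / (real (kH1 VH EH) - 1) - C * ln (real n) \<le> real (chiH VH EH n E) \<and>
          real (chiH VH EH n E) \<le> real n / (real (kH1 VH EH) - 1) + C' * (real n / log d (real n))))
        \<longlonglongrightarrow> 1" if k12: "kH1 VH EH \<ge> 3 \<and> kH2 VH EH \<ge> 2"
  proof -
    define r where "r = k - 1"
    have k3: "k \<ge> 2" "r \<ge> 2" using k12 by (auto simp: k_def r_def)
    show ?thesis
      unfolding k_def[symmetric]
      by (intro exI, rule gnp_chiH_bounds_tendsto_1[OF p H k3(1) parts[OF conjunct2[OF k12]] q01[OF k3(1)] nocopy[OF k3(1)]
            gnp_no_indep_subset_tendsto_0[OF p k3(2)]
            eventually_chiH_le_greedy[OF H d1 conjunct1[OF k12] r_def[unfolded k_def], folded k_def]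
            eventually_lower_bound_from_blocks[OF q01[OF k3(1)] k3(1)]])
  qed
  have ii: "\<exists>C C'. (\<lambda>n. gnp_prob n p (\<lambda>E.
          real n - C * ln (real n) \<le> real (chiH VH EH n E) \<and>
          real (chiH VH EH n E) \<le> real n - 2 * log d (real n) + C' * log d (ln (real n))))
        \<longlonglongrightarrow> 1" if k12: "kH1 VH EH = 2 \<and> kH2 VH EH = 2"
  proof -
    have k2: "k \<ge> 2" "k = 2" and kH2: "kH2 VH EH \<ge> 2" using k12 by (auto simp: k_def)
    have lower: "\<forall>\<^sub>F n in sequentially. \<forall>x. real n \<le> (real k - 1) * x +
       real k * (2 * real k * log (1 / q) (real n) - log (1 / q) (ln (real n))) \<longrightarrow>
       real n - 8 / ln (1 / q) * ln (real n) \<le> x"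
      using eventually_lower_bound_from_blocks[OF q01[OF k2(1)] k2(1)] by (simp add: k2(2))
    show ?thesis
      by (intro exI, rule gnp_chiH_bounds_tendsto_1[OF p H k2(1) parts[OF kH2] q01[OF k2(1)] nocopy[OF k2(1)]
            gnp_no_indep_set_tendsto_0[OF p d]
            eventually_chiH_le_indep_size[OF H d1 parts[OF kH2]] lower])
  qed
  have iii: "\<exists>c C'. c > 0 \<and> (\<lambda>n. gnp_prob n p (\<lambda>E.
          real n - 8 * log (1 / Q) (real n) + c * log (1 / Q) (ln (real n)) \<le> real (chiH V2K2 E2K2 n E) \<and>
          real (chiH V2K2 E2K2 n E) \<le> real n - 2 * log d (real n) + C' * log d (ln (real n))))
        \<longlonglongrightarrow> 1" if Q: "Q = 1 - 2 * p\<^sup>2 * (1 - p)\<^sup>2" for Q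
  proof -
    have "p * (1 - p) \<le> 1 / 4"
      using zero_le_power2[of "p - 1 / 2"] by (simp add: power2_eq_square algebra_simps)
    then have "(p * (1 - p)) ^ 2 \<le> (1 / 4) ^ 2" using p by (intro power_mono) auto
    moreover have "(p * (1 - p)) ^ 2 > 0" using p by simp
    moreover have "Q = 1 - 2 * (p * (1 - p)) ^ 2" by (simp add: Q power_mult_distrib)
    ultimately have Q01: "0 < Q" "Q < 1" by (simp_all add: power_divide)
    have lower: "\<forall>\<^sub>F n in sequentially. \<forall>x. real n \<le> (real 2 - 1) * x +
       real 2 * (2 * real 2 * log (1 / Q) (real n) - log (1 / Q) (ln (real n))) \<longrightarrow>
       real n - 8 * log (1 / Q) (real n) + 2 * log (1 / Q) (ln (real n)) \<le> x"
      by (intro always_eventually allI impI) simp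
    have "(\<lambda>n. gnp_prob n p (\<lambda>E.
          real n - 8 * log (1 / Q) (real n) + 2 * log (1 / Q) (ln (real n)) \<le> real (chiH V2K2 E2K2 n E) \<and>
          real (chiH V2K2 E2K2 n E) \<le> real n - 2 * log d (real n) + 7 * log d (ln (real n))))
        \<longlonglongrightarrow> 1"
      by (rule gnp_chiH_bounds_tendsto_1[OF p simple_graph_2K2 order.refl bip_parts_2K2 Q01
            epr_no_2K2_le[OF p, folded Q] gnp_no_indep_set_tendsto_0[OF p d]
            eventually_chiH_le_indep_size[OF simple_graph_2K2 d1 bip_parts_2K2] lower])
    then show ?thesis by (intro exI[of _ 2] exI[of _ 7]) simp
  qed
  show ?thesis unfolding Let_def using i ii iii by blast
qed

end
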